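(* Let $G$ be a compact Vilenkin group with an associated sequence of compact open normal subgroups $(G_n)_{n\in\mathbb{N}_0}$. Then the group $K_0(C(G))$ is generated by the equivalence classes of the continuous functions $\mathbf{1}_{xG_r}$ for all $r\in\mathbb{N}_0$ and $[x]\in G/G_r$.
   Context: A topological group $G$ is a compact Vilenkin group if it possesses a strictly decreasing sequence $G=G_0\supset G_1\supset G_2\supset\cdots$ of compact open normal subgroups of $G$ (the associated sequence) such that (i) $2\le |G_n/G_{n+1}|<\infty$ for all $n\in\mathbb{N}_0$; (ii) $(G_n)_{n\in\mathbb{N}_0}$ is a basis of neighbourhoods at the identity $e$ and $\bigcap_{n}G_n=\{e\}$. $K_0$ denotes operator $K$-theory of $C^*$-algebras; $\mathbf{1}_{B}$ denotes the characteristic function of $B\subseteq G$, and $\mathbf{1}_{xG_r}$ is a projection in $C(G)$ because $xG_r$ is clopen. *)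

theory Defs
  imports "HOL-Analysis.Analysis" "HOL-Algebra.Ring" "HOL-Algebra.Generated_Groups"
begin

section \<open>Rings with involution\<close>

text \<open>
  Operator \<open>K\<^sub>0\<close> of a unital \<open>C\<close>*-algebra is built from its ring structure and its involution alone
  (the norm and the scalars do not occur in the definition), so a \<open>C\<close>*-algebra is represented by its
  underlying unital ring with involution.
\<close>

record 'a star_ring = "'a ring" +
  star :: "'a \<Rightarrow> 'a"

locale star_ring = ring R for R :: "('a, 'm) star_ring_scheme" (structure) +
  assumes star_closed [simp]: "a \<in> carrier R \<Longrightarrow> star R a \<in> carrier R"
    and star_star [simp]: "a \<in> carrier R \<Longrightarrow> star R (star R a) = a"
    and star_add: "\<lbrakk>a \<in> carrier R; b \<in> carrier R\<rbrakk> \<Longrightarrow> star R (a \<oplus> b) = star R a \<oplus> star R b"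
    and star_mult: "\<lbrakk>a \<in> carrier R; b \<in> carrier R\<rbrakk> \<Longrightarrow> star R (a \<otimes> b) = star R b \<otimes> star R a"

section \<open>Matrices over a ring with involution\<close>

text \<open>An \<open>m \<times> n\<close> matrix is a doubly indexed family that vanishes outside \<open>{..<m} \<times> {..<n}\<close>.\<close>

definition mats :: "('a, 'm) ring_scheme \<Rightarrow> nat \<Rightarrow> nat \<Rightarrow> (nat \<Rightarrow> nat \<Rightarrow> 'a) set" where
  "mats R m n = {v. (\<forall>i j. v i j \<in> carrier R) \<and> (\<forall>i j. i \<ge> m \<or> j \<ge> n \<longrightarrow> v i j = \<zero>\<^bsub>R\<^esub>)}"

text \<open>The product of an \<open>l \<times> k\<close> and a \<open>k \<times> n\<close> matrix; only the inner dimension \<open>k\<close> matters.\<close>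

definition mat_prod ::
    "('a, 'm) ring_scheme \<Rightarrow> nat \<Rightarrow> (nat \<Rightarrow> nat \<Rightarrow> 'a) \<Rightarrow> (nat \<Rightarrow> nat \<Rightarrow> 'a) \<Rightarrow> nat \<Rightarrow> nat \<Rightarrow> 'a" where
  "mat_prod R k v w = (\<lambda>i j. \<Oplus>\<^bsub>R\<^esub>l\<in>{..<k}. v i l \<otimes>\<^bsub>R\<^esub> w l j)"

definition mat_star :: "('a, 'm) star_ring_scheme \<Rightarrow> (nat \<Rightarrow> nat \<Rightarrow> 'a) \<Rightarrow> nat \<Rightarrow> nat \<Rightarrow> 'a" where
  "mat_star R v = (\<lambda>i j. star R (v j i))"

text \<open>\<open>block_diag R m n v w\<close> is the block matrix \<open>diag(v, w)\<close> whose upper left block \<open>v\<close> is \<open>m \<times> n\<close>.\<close>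

definition block_diag :: "('a, 'm) ring_scheme \<Rightarrow> nat \<Rightarrow> nat \<Rightarrow>
    (nat \<Rightarrow> nat \<Rightarrow> 'a) \<Rightarrow> (nat \<Rightarrow> nat \<Rightarrow> 'a) \<Rightarrow> nat \<Rightarrow> nat \<Rightarrow> 'a" where
  "block_diag R m n v w = (\<lambda>i j.
     if i < m \<and> j < n then v i j
     else if m \<le> i \<and> n \<le> j then w (i - m) (j - n)
     else \<zero>\<^bsub>R\<^esub>)"

section \<open>The semigroup of Murray--von Neumann classes of projections\<close>

text \<open>
  The disjoint union over \<open>n \<ge> 1\<close> of the sets of projections \<open>p = p\<^sup>* = p\<^sup>2\<close> in \<open>M\<^sub>n(R)\<close>;
  the first component records the size \<open>n\<close>.
\<close>

definition projections :: "('a, 'm) star_ring_scheme \<Rightarrow> (nat \<times> (nat \<Rightarrow> nat \<Rightarrow> 'a)) set" where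
  "projections R = {(n, p). n \<ge> 1 \<and> p \<in> mats R n n \<and> mat_star R p = p \<and> mat_prod R n p p = p}"

definition block_sum :: "('a, 'm) ring_scheme \<Rightarrow> nat \<times> (nat \<Rightarrow> nat \<Rightarrow> 'a) \<Rightarrow>
    nat \<times> (nat \<Rightarrow> nat \<Rightarrow> 'a) \<Rightarrow> nat \<times> (nat \<Rightarrow> nat \<Rightarrow> 'a)" where
  "block_sum R = (\<lambda>(m, p) (n, q). (m + n, block_diag R m m p q))"

text \<open>\<open>p \<in> M\<^sub>n(R)\<close> and \<open>q \<in> M\<^sub>m(R)\<close> are related iff \<open>p = v\<^sup>*v\<close> and \<open>q = vv\<^sup>*\<close> for some \<open>m \<times> n\<close> matrix \<open>v\<close>.\<close>

definition mvn_rel :: "('a, 'm) star_ring_scheme \<Rightarrow>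
    ((nat \<times> (nat \<Rightarrow> nat \<Rightarrow> 'a)) \<times> (nat \<times> (nat \<Rightarrow> nat \<Rightarrow> 'a))) set" where
  "mvn_rel R = {((n, p), (m, q)). (n, p) \<in> projections R \<and> (m, q) \<in> projections R \<and>
     (\<exists>v \<in> mats R m n. p = mat_prod R m (mat_star R v) v \<and> q = mat_prod R n v (mat_star R v))}"

definition mvn_monoid :: "('a, 'm) star_ring_scheme \<Rightarrow> (nat \<times> (nat \<Rightarrow> nat \<Rightarrow> 'a)) set monoid" where
  "mvn_monoid R =
    \<lparr>carrier = projections R // mvn_rel R,
     mult = (\<lambda>X Y. \<Union>x\<in>X. \<Union>y\<in>Y. mvn_rel R `` {block_sum R x y}),
     one = mvn_rel R `` {(1, \<lambda>_ _. \<zero>\<^bsub>R\<^esub>)}\<rparr>"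

section \<open>The Grothendieck group and \<open>K\<^sub>0\<close>\<close>

definition Grothendieck_rel :: "('a, 'm) monoid_scheme \<Rightarrow> (('a \<times> 'a) \<times> ('a \<times> 'a)) set" where
  "Grothendieck_rel M = {((a, b), (c, d)).
     a \<in> carrier M \<and> b \<in> carrier M \<and> c \<in> carrier M \<and> d \<in> carrier M \<and>
     (\<exists>e \<in> carrier M. a \<otimes>\<^bsub>M\<^esub> d \<otimes>\<^bsub>M\<^esub> e = c \<otimes>\<^bsub>M\<^esub> b \<otimes>\<^bsub>M\<^esub> e)}"

definition Grothendieck_group :: "('a, 'm) monoid_scheme \<Rightarrow> ('a \<times> 'a) set monoid" where
  "Grothendieck_group M =
    \<lparr>carrier = (carrier M \<times> carrier M) // Grothendieck_rel M,
     mult = (\<lambda>X Y. \<Union>x\<in>X. \<Union>y\<in>Y. Grothendieck_rel M `` {(fst x \<otimes>\<^bsub>M\<^esub> fst y, snd x \<otimes>\<^bsub>M\<^esub> snd y)}),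
     one = Grothendieck_rel M `` {(\<one>\<^bsub>M\<^esub>, \<one>\<^bsub>M\<^esub>)}\<rparr>"

definition K0 :: "('a, 'm) star_ring_scheme \<Rightarrow>
    ((nat \<times> (nat \<Rightarrow> nat \<Rightarrow> 'a)) set \<times> (nat \<times> (nat \<Rightarrow> nat \<Rightarrow> 'a)) set) set monoid" where
  "K0 R = Grothendieck_group (mvn_monoid R)"

text \<open>The class in \<open>K\<^sub>0(R)\<close> of a projection of \<open>R\<close> itself, regarded as a \<open>1 \<times> 1\<close> matrix.\<close>

definition K0_class :: "('a, 'm) star_ring_scheme \<Rightarrow> 'a \<Rightarrow>
    ((nat \<times> (nat \<Rightarrow> nat \<Rightarrow> 'a)) set \<times> (nat \<times> (nat \<Rightarrow> nat \<Rightarrow> 'a)) set) set" where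
  "K0_class R p = Grothendieck_rel (mvn_monoid R) ``
     {(mvn_rel R `` {(1, \<lambda>i j. if i = 0 \<and> j = 0 then p else \<zero>\<^bsub>R\<^esub>)}, \<one>\<^bsub>mvn_monoid R\<^esub>)}"

section \<open>The algebra \<open>C(X)\<close>\<close>

definition cont_fun_alg :: "'a topology \<Rightarrow> ('a \<Rightarrow> complex) star_ring" where
  "cont_fun_alg X =
    \<lparr>carrier = {f. f \<in> extensional (topspace X) \<and> continuous_map X euclidean f},
     mult = (\<lambda>f g. \<lambda>x\<in>topspace X. f x * g x),
     one = (\<lambda>x\<in>topspace X. 1),
     zero = (\<lambda>x\<in>topspace X. 0),
     add = (\<lambda>f g. \<lambda>x\<in>topspace X. f x + g x),
     star = (\<lambda>f. \<lambda>x\<in>topspace X. cnj (f x))\<rparr>"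

definition char_fun :: "'a topology \<Rightarrow> 'a set \<Rightarrow> 'a \<Rightarrow> complex" where
  "char_fun X B = (\<lambda>x\<in>topspace X. indicator B x)"

section \<open>Compact Vilenkin groups\<close>

definition topological_group :: "('g, 'm) monoid_scheme \<Rightarrow> 'g topology \<Rightarrow> bool" where
  "topological_group G T \<longleftrightarrow> group G \<and> topspace T = carrier G \<and>
     continuous_map (prod_topology T T) T (\<lambda>(x, y). x \<otimes>\<^bsub>G\<^esub> y) \<and>
     continuous_map T T (\<lambda>x. inv\<^bsub>G\<^esub> x)"

definition associated_sequence ::
    "('g, 'm) monoid_scheme \<Rightarrow> 'g topology \<Rightarrow> (nat \<Rightarrow> 'g set) \<Rightarrow> bool" where
  "associated_sequence G T N \<longleftrightarrow>
     N 0 = carrier G \<and>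
     (\<forall>n. N (Suc n) \<subset> N n) \<and>
     (\<forall>n. N n \<lhd> G \<and> compactin T (N n) \<and> openin T (N n)) \<and>
     (\<forall>n. finite (carrier (G\<lparr>carrier := N n\<rparr> Mod N (Suc n))) \<and>
          2 \<le> order (G\<lparr>carrier := N n\<rparr> Mod N (Suc n))) \<and>
     (\<forall>U. openin T U \<and> \<one>\<^bsub>G\<^esub> \<in> U \<longrightarrow> (\<exists>n. N n \<subseteq> U)) \<and>
     (\<Inter>n. N n) = {\<one>\<^bsub>G\<^esub>}"

definition compact_Vilenkin_group :: "('g, 'm) monoid_scheme \<Rightarrow> 'g topology \<Rightarrow> bool" where
  "compact_Vilenkin_group G T \<longleftrightarrow> topological_group G T \<and> (\<exists>N. associated_sequence G T N)"

section \<open>Well-definedness\<close>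

lemma (in star_ring) star_zero [simp]: "star R \<zero> = \<zero>"
proof -
  have "star R \<zero> \<oplus> star R \<zero> = star R \<zero>" using star_add[of \<zero> \<zero>] by simp
  then show ?thesis by (metis add.l_cancel_one' star_closed zero_closed)
qed

lemma (in star_ring) star_finsum:
  assumes "finite A" "f \<in> A \<rightarrow> carrier R"
  shows "star R (\<Oplus>i\<in>A. f i) = (\<Oplus>i\<in>A. star R (f i))"
  using assms by (induction A rule: finite_induct) (auto simp: star_add Pi_iff)

lemma (in abelian_monoid) finsum_swap:
  assumes "finite A" "finite B" "\<And>i j. i \<in> A \<Longrightarrow> j \<in> B \<Longrightarrow> f i j \<in> carrier G"
  shows "(\<Oplus>i\<in>A. \<Oplus>j\<in>B. f i j) = (\<Oplus>j\<in>B. \<Oplus>i\<in>A. f i j)"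
  using assms
proof (induction A rule: finite_induct)
  case (insert x A)
  have "(\<Oplus>j\<in>B. \<Oplus>i\<in>insert x A. f i j) = (\<Oplus>j\<in>B. f x j \<oplus> (\<Oplus>i\<in>A. f i j))"
    by (rule finsum_cong') (use insert in \<open>auto intro!: finsum_insert\<close>)
  also have "\<dots> = (\<Oplus>j\<in>B. f x j) \<oplus> (\<Oplus>j\<in>B. \<Oplus>i\<in>A. f i j)"
    by (rule finsum_addf) (use insert in auto)
  finally show ?case using insert by (subst finsum_insert) auto
qed simp

context star_ring
begin

lemma matsD: "v \<in> mats R m n \<Longrightarrow> v i j \<in> carrier R"
  by (auto simp: mats_def)

lemma mats_zero: "v \<in> mats R m n \<Longrightarrow> i \<ge> m \<or> j \<ge> n \<Longrightarrow> v i j = \<zero>"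
  by (auto simp: mats_def)

lemma mat_prod_closed:
  assumes "v \<in> mats R l k" "w \<in> mats R k' n"
  shows "mat_prod R k v w \<in> mats R l n"
proof -
  have "(\<Oplus>h\<in>{..<k}. v i h \<otimes> w h j) = \<zero>" if "i \<ge> l \<or> j \<ge> n" for i j
    using that matsD[OF assms(1)] matsD[OF assms(2)] mats_zero[OF assms(1)] mats_zero[OF assms(2)]
    by (intro add.finprod_one_eqI) auto
  then show ?thesis
    using matsD[OF assms(1)] matsD[OF assms(2)] by (auto simp: mats_def mat_prod_def)
qed

lemma mat_star_closed: "v \<in> mats R m n \<Longrightarrow> mat_star R v \<in> mats R n m"
  by (auto simp: mats_def mat_star_def)

lemma mat_star_star: "v \<in> mats R m n \<Longrightarrow> mat_star R (mat_star R v) = v"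
  by (auto simp: mats_def mat_star_def)

lemma mat_star_prod:
  assumes "v \<in> mats R l k" "w \<in> mats R k n"
  shows "mat_star R (mat_prod R k v w) = mat_prod R k (mat_star R w) (mat_star R v)"
  unfolding mat_star_def mat_prod_def using matsD[OF assms(1)] matsD[OF assms(2)]
  by (intro ext, subst star_finsum) (auto simp: star_mult intro!: finsum_cong)

lemma mat_prod_assoc:
  assumes a: "a \<in> mats R l m" and b: "b \<in> mats R m n" and c: "c \<in> mats R n k"
  shows "mat_prod R n (mat_prod R m a b) c = mat_prod R m a (mat_prod R n b c)"
proof (intro ext)
  fix i j
  note [simp] = matsD[OF a] matsD[OF b] matsD[OF c]
  have "mat_prod R n (mat_prod R m a b) c i j
      = (\<Oplus>h\<in>{..<n}. \<Oplus>g\<in>{..<m}. a i g \<otimes> b g h \<otimes> c h j)"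
    unfolding mat_prod_def by (intro finsum_cong') (auto simp: finsum_ldistr)
  also have "\<dots> = (\<Oplus>g\<in>{..<m}. \<Oplus>h\<in>{..<n}. a i g \<otimes> b g h \<otimes> c h j)"
    by (rule finsum_swap) auto
  also have "\<dots> = mat_prod R m a (mat_prod R n b c) i j"
    unfolding mat_prod_def by (intro finsum_cong') (auto simp: finsum_rdistr m_assoc)
  finally show "mat_prod R n (mat_prod R m a b) c i j = mat_prod R m a (mat_prod R n b c) i j" .
qed

text \<open>Zero padding: the inner dimension may be enlarged.\<close>

lemma mat_prod_pad:
  assumes "v \<in> mats R l k" "w \<in> mats R k' n" "k \<le> K"
  shows "mat_prod R K v w = mat_prod R k v w"
  unfolding mat_prod_def
  using matsD[OF assms(1)] matsD[OF assms(2)] mats_zero[OF assms(1)] assms(3)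
  by (intro ext add.finprod_mono_neutral_cong_right) auto

lemma block_diag_closed:
  assumes "v \<in> mats R m n" "w \<in> mats R m' n'"
  shows "block_diag R m n v w \<in> mats R (m + m') (n + n')"
  using assms by (auto simp: mats_def block_diag_def)

lemma block_diag_star:
  "mat_star R (block_diag R m n v w) = block_diag R n m (mat_star R v) (mat_star R w)"
  by (auto simp: mat_star_def block_diag_def fun_eq_iff)

lemma block_diag_prod:
  assumes a: "a \<in> mats R m k" and b: "b \<in> mats R m' k'" and c: "c \<in> mats R k n" and d: "d \<in> mats R k' n'"
  shows "mat_prod R (k + k') (block_diag R m k a b) (block_diag R k n c d)
    = block_diag R m n (mat_prod R k a c) (mat_prod R k' b d)"
proof (intro ext)
  fix i j
  let ?x = "block_diag R m k a b" and ?y = "block_diag R k n c d"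
  note [simp] = matsD[OF a] matsD[OF b] matsD[OF c] matsD[OF d]
  have cl: "?x i h \<in> carrier R" "?y h j \<in> carrier R" for i j h
    by (auto simp: block_diag_def)
  have un: "{..<k + k'} = {..<k} \<union> (+) k ` {..<k'}"
    by (simp only: lessThan_atLeast0 image_add_atLeastLessThan add_0_right) auto
  have "(\<Oplus>h\<in>{..<k + k'}. ?x i h \<otimes> ?y h j)
      = (\<Oplus>h\<in>{..<k}. ?x i h \<otimes> ?y h j) \<oplus> (\<Oplus>h\<in>(+) k ` {..<k'}. ?x i h \<otimes> ?y h j)"
    unfolding un by (rule finsum_Un_disjoint) (auto simp: cl)
  also have "(\<Oplus>h\<in>(+) k ` {..<k'}. ?x i h \<otimes> ?y h j) = (\<Oplus>h\<in>{..<k'}. ?x i (k + h) \<otimes> ?y (k + h) j)"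
    by (rule finsum_reindex) (auto simp: cl)
  also have "(\<Oplus>h\<in>{..<k}. ?x i h \<otimes> ?y h j)
      = (if i < m \<and> j < n then (\<Oplus>h\<in>{..<k}. a i h \<otimes> c h j) else \<zero>)"
    by (auto intro!: add.finprod_one_eqI finsum_cong' simp: block_diag_def)
  also have "(\<Oplus>h\<in>{..<k'}. ?x i (k + h) \<otimes> ?y (k + h) j)
      = (if m \<le> i \<and> n \<le> j then (\<Oplus>h\<in>{..<k'}. b (i - m) h \<otimes> d h (j - n)) else \<zero>)"
    by (auto intro!: add.finprod_one_eqI finsum_cong' simp: block_diag_def)
  finally show "mat_prod R (k + k') ?x ?y i j
      = block_diag R m n (mat_prod R k a c) (mat_prod R k' b d) i j"
    unfolding mat_prod_def by (auto simp: block_diag_def)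
qed

lemma projectionsD:
  assumes "(n, p) \<in> projections R"
  shows "n \<ge> 1" "p \<in> mats R n n" "mat_star R p = p" "mat_prod R n p p = p"
  using assms by (auto simp: projections_def)

lemma mvn_relI:
  assumes "(n, p) \<in> projections R" "(m, q) \<in> projections R" "v \<in> mats R m n"
    "p = mat_prod R m (mat_star R v) v" "q = mat_prod R n v (mat_star R v)"
  shows "((n, p), (m, q)) \<in> mvn_rel R"
  using assms by (auto simp: mvn_rel_def)

lemma mvn_relE:
  assumes "((n, p), (m, q)) \<in> mvn_rel R"
  obtains v where "(n, p) \<in> projections R" "(m, q) \<in> projections R" "v \<in> mats R m n"
    "p = mat_prod R m (mat_star R v) v" "q = mat_prod R n v (mat_star R v)"
  using assms by (auto simp: mvn_rel_def)

lemma equiv_mvn_rel: "equiv (projections R) (mvn_rel R)"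
proof (rule equivI)
  show "mvn_rel R \<subseteq> projections R \<times> projections R" by (auto simp: mvn_rel_def)
  show "refl_on (projections R) (mvn_rel R)"
  proof (rule refl_onI)
    fix x assume "x \<in> projections R"
    then show "(x, x) \<in> mvn_rel R"
      using mvn_relI[of "fst x" "snd x" "fst x" "snd x" "snd x"] projectionsD[of "fst x" "snd x"]
      by simp
  qed
  show "sym (mvn_rel R)"
  proof (rule symI, clarify)
    fix n p m q assume "((n, p), (m, q)) \<in> mvn_rel R"
    then obtain v where v: "(n, p) \<in> projections R" "(m, q) \<in> projections R" "v \<in> mats R m n"
      "p = mat_prod R m (mat_star R v) v" "q = mat_prod R n v (mat_star R v)" by (rule mvn_relE)
    show "((m, q), (n, p)) \<in> mvn_rel R"
      by (rule mvn_relI[OF v(2,1) mat_star_closed[OF v(3)]]) (simp_all add: v mat_star_star[OF v(3)])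
  qed
  show "trans (mvn_rel R)"
  proof (rule transI, clarify)
    fix n p m q l r
    assume "((n, p), (m, q)) \<in> mvn_rel R"
    then obtain v where v: "(n, p) \<in> projections R" "(m, q) \<in> projections R" "v \<in> mats R m n"
      "p = mat_prod R m (mat_star R v) v" "q = mat_prod R n v (mat_star R v)" by (rule mvn_relE)
    assume "((m, q), (l, r)) \<in> mvn_rel R"
    then obtain w where w: "(l, r) \<in> projections R" "w \<in> mats R l m"
      "q = mat_prod R l (mat_star R w) w" "r = mat_prod R m w (mat_star R w)" by (auto elim: mvn_relE)
    note vs = mat_star_closed[OF v(3)] and ws = mat_star_closed[OF w(2)]
    note p = projectionsD[OF v(1)] and q = projectionsD[OF v(2)] and r = projectionsD[OF w(1)]
    have st: "mat_star R (mat_prod R m w v) = mat_prod R m (mat_star R v) (mat_star R w)"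
      by (rule mat_star_prod[OF w(2) v(3)])
    have qv: "mat_prod R m q v = mat_prod R n v p"
      unfolding v(4,5) by (rule mat_prod_assoc[OF v(3) vs v(3)])
    have qw: "mat_prod R m q (mat_star R w) = mat_prod R l (mat_star R w) r"
      unfolding w(3,4) by (rule mat_prod_assoc[OF ws w(2) ws])
    have "mat_prod R l (mat_prod R m (mat_star R v) (mat_star R w)) (mat_prod R m w v)
        = mat_prod R m (mat_star R v) (mat_prod R l (mat_star R w) (mat_prod R m w v))"
      by (rule mat_prod_assoc[OF vs ws mat_prod_closed[OF w(2) v(3)]])
    also have "mat_prod R l (mat_star R w) (mat_prod R m w v) = mat_prod R n v p"
      using mat_prod_assoc[OF ws w(2) v(3)] w(3) qv by simp
    also have "mat_prod R m (mat_star R v) (mat_prod R n v p) = p"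
      using mat_prod_assoc[OF vs v(3) p(2)] v(4) p(4) by simp
    finally have 1: "p = mat_prod R l (mat_star R (mat_prod R m w v)) (mat_prod R m w v)"
      unfolding st by simp
    have "mat_prod R n (mat_prod R m w v) (mat_prod R m (mat_star R v) (mat_star R w))
        = mat_prod R m w (mat_prod R n v (mat_prod R m (mat_star R v) (mat_star R w)))"
      by (rule mat_prod_assoc[OF w(2) v(3) mat_prod_closed[OF vs ws]])
    also have "mat_prod R n v (mat_prod R m (mat_star R v) (mat_star R w)) = mat_prod R l (mat_star R w) r"
      using mat_prod_assoc[OF v(3) vs ws] v(5) qw by simp
    also have "mat_prod R m w (mat_prod R l (mat_star R w) r) = r"
      using mat_prod_assoc[OF w(2) ws r(2)] w(4) r(4) by simp
    finally have 2: "r = mat_prod R n (mat_prod R m w v) (mat_star R (mat_prod R m w v))"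
      unfolding st by simp
    show "((n, p), (l, r)) \<in> mvn_rel R"
      by (rule mvn_relI[OF v(1) w(1) mat_prod_closed[OF w(2) v(3)] 1 2])
  qed
qed

lemma block_sum_closed:
  assumes "x \<in> projections R" "y \<in> projections R"
  shows "block_sum R x y \<in> projections R"
proof -
  obtain m p n q where xy: "x = (m, p)" "y = (n, q)" by (cases x, cases y)
  note p = projectionsD[OF assms(1)[unfolded xy]] and q = projectionsD[OF assms(2)[unfolded xy]]
  show ?thesis
    using block_diag_closed[OF p(2) q(2)] block_diag_prod[OF p(2) q(2) p(2) q(2)] p q
    by (simp add: xy projections_def block_sum_def block_diag_star)
qed

lemma block_sum_cong:
  assumes "(x, x') \<in> mvn_rel R" "(y, y') \<in> mvn_rel R"
  shows "(block_sum R x y, block_sum R x' y') \<in> mvn_rel R"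
proof -
  obtain n p m q where x: "x = (n, p)" "x' = (m, q)" by (cases x, cases x')
  obtain k r l s where y: "y = (k, r)" "y' = (l, s)" by (cases y, cases y')
  obtain v where v: "(n, p) \<in> projections R" "(m, q) \<in> projections R" "v \<in> mats R m n"
      "p = mat_prod R m (mat_star R v) v" "q = mat_prod R n v (mat_star R v)"
    using assms(1) unfolding x by (rule mvn_relE)
  obtain w where w: "(k, r) \<in> projections R" "(l, s) \<in> projections R" "w \<in> mats R l k"
      "r = mat_prod R l (mat_star R w) w" "s = mat_prod R k w (mat_star R w)"
    using assms(2) unfolding y by (rule mvn_relE)
  note vs = mat_star_closed[OF v(3)] and ws = mat_star_closed[OF w(3)]
  have "((n + k, block_diag R n n p r), (m + l, block_diag R m m q s)) \<in> mvn_rel R"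
  proof (rule mvn_relI[where v = "block_diag R m n v w"])
    show "(n + k, block_diag R n n p r) \<in> projections R" "(m + l, block_diag R m m q s) \<in> projections R"
      using block_sum_closed[OF v(1) w(1)] block_sum_closed[OF v(2) w(2)] by (simp_all add: block_sum_def)
    show "block_diag R m n v w \<in> mats R (m + l) (n + k)" by (rule block_diag_closed[OF v(3) w(3)])
    show "block_diag R n n p r
        = mat_prod R (m + l) (mat_star R (block_diag R m n v w)) (block_diag R m n v w)"
      using block_diag_prod[OF vs ws v(3) w(3)] v(4) w(4) by (simp add: block_diag_star)
    show "block_diag R m m q s
        = mat_prod R (n + k) (block_diag R m n v w) (mat_star R (block_diag R m n v w))"
      using block_diag_prod[OF v(3) w(3) vs ws] v(5) w(5) by (simp add: block_diag_star)
  qed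
  then show ?thesis by (simp add: x y block_sum_def)
qed

lemma block_sum_assoc: "block_sum R (block_sum R x y) z = block_sum R x (block_sum R y z)"
  by (cases x; cases y; cases z) (auto simp: block_sum_def block_diag_def fun_eq_iff)

text \<open>Conjugating a projection by a permutation matrix.\<close>

lemma mvn_rel_permute:
  assumes p: "(n, p) \<in> projections R" and s: "bij_betw s {..<n} {..<n}" "\<And>i. i \<ge> n \<Longrightarrow> s i \<ge> n"
  shows "((n, p), (n, \<lambda>i j. p (s i) (s j))) \<in> mvn_rel R"
proof -
  note pD = projectionsD[OF p]
  have cl [simp]: "p i j \<in> carrier R" for i j by (rule matsD[OF pD(2)])
  have st: "star R (p i j) = p j i" for i j
    using fun_cong[OF fun_cong[OF pD(3), of j], of i] by (simp add: mat_star_def)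
  have sq: "(\<Oplus>h\<in>{..<n}. p i h \<otimes> p h j) = p i j" for i j
    using fun_cong[OF fun_cong[OF pD(4), of i], of j] by (simp add: mat_prod_def)
  have sqs: "(\<Oplus>h\<in>{..<n}. p i (s h) \<otimes> p (s h) j) = p i j" for i j
  proof -
    have "(\<Oplus>h\<in>s ` {..<n}. p i h \<otimes> p h j) = (\<Oplus>h\<in>{..<n}. p i (s h) \<otimes> p (s h) j)"
      by (rule finsum_reindex) (use s in \<open>auto simp: bij_betw_def\<close>)
    then show ?thesis using s(1) sq by (simp add: bij_betw_def)
  qed
  let ?q = "\<lambda>i j. p (s i) (s j)" and ?v = "\<lambda>i j. p (s i) j"
  have q: "(n, ?q) \<in> projections R"
    using pD(1) mats_zero[OF pD(2)] s(2)
    by (auto simp: projections_def mats_def mat_star_def mat_prod_def st sqs)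
  show ?thesis
    by (rule mvn_relI[OF p q, of ?v])
      (use mats_zero[OF pD(2)] s(2) in \<open>auto simp: mats_def mat_star_def mat_prod_def st sqs sq fun_eq_iff\<close>)
qed

lemma block_sum_comm:
  assumes "x \<in> projections R" "y \<in> projections R"
  shows "(block_sum R x y, block_sum R y x) \<in> mvn_rel R"
proof -
  obtain m p n q where xy: "x = (m, p)" "y = (n, q)" by (cases x, cases y)
  note p = projectionsD[OF assms(1)[unfolded xy]] and q = projectionsD[OF assms(2)[unfolded xy]]
  define s where "s = (\<lambda>i. if i < n then i + m else if i < n + m then i - n else i)"
  have "bij_betw s {..<m + n} {..<m + n}"
    by (rule bij_betwI[where g = "\<lambda>i. if i < m then i + n else if i < n + m then i - m else i"])
      (auto simp: s_def)
  then have "((m + n, block_diag R m m p q), (m + n, \<lambda>i j. block_diag R m m p q (s i) (s j))) \<in> mvn_rel R"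
    using block_sum_closed[OF assms] by (intro mvn_rel_permute) (auto simp: xy block_sum_def s_def)
  moreover have "(\<lambda>i j. block_diag R m m p q (s i) (s j)) = block_diag R n n q p"
  proof (intro ext)
    fix i j
    have z: "m \<le> i \<Longrightarrow> p i j = \<zero>" "m \<le> j \<Longrightarrow> p i j = \<zero>"
      "n \<le> i \<Longrightarrow> q i j = \<zero>" "n \<le> j \<Longrightarrow> q i j = \<zero>" for i j
      using mats_zero[OF p(2)] mats_zero[OF q(2)] by auto
    show "block_diag R m m p q (s i) (s j) = block_diag R n n q p i j"
      by (auto simp: block_diag_def s_def z)
  qed
  ultimately show ?thesis by (simp add: xy block_sum_def add.commute)
qed

lemma zero_projection: "(n, \<lambda>_ _. \<zero>) \<in> projections R" if "n \<ge> 1"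
  using that by (auto simp: projections_def mats_def mat_star_def mat_prod_def)

lemma block_sum_zero:
  assumes "x \<in> projections R"
  shows "(block_sum R (1, \<lambda>_ _. \<zero>) x, x) \<in> mvn_rel R"
proof -
  obtain n p where x: "x = (n, p)" by (cases x)
  note p = projectionsD[OF assms[unfolded x]]
  have blk: "block_diag R n n p (\<lambda>_ _. \<zero>) = p"
    using mats_zero[OF p(2)] by (intro ext) (auto simp: block_diag_def)
  have z: "(1, \<lambda>_ _. \<zero>) \<in> projections R" by (rule zero_projection) simp
  have cl: "(n + 1, p) \<in> projections R"
    using block_sum_closed[OF assms z] by (simp add: x block_sum_def blk)
  have "((n + 1, p), (n, p)) \<in> mvn_rel R"
  proof (rule mvn_relI[OF cl assms[unfolded x]])
    show "p \<in> mats R n (n + 1)" using p(2) by (auto simp: mats_def)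
    show "p = mat_prod R (n + 1) p (mat_star R p)"
      using mat_prod_pad[OF p(2,2), of "n + 1"] p by simp
  qed (use p in simp)
  then have "(block_sum R x (1, \<lambda>_ _. \<zero>), x) \<in> mvn_rel R" by (simp add: x block_sum_def blk)
  then show ?thesis
    using block_sum_comm[OF z assms] equiv_mvn_rel unfolding equiv_def by (meson transD)
qed

lemma mvn_mult:
  assumes "x \<in> projections R" "y \<in> projections R"
  shows "mvn_rel R `` {x} \<otimes>\<^bsub>mvn_monoid R\<^esub> mvn_rel R `` {y} = mvn_rel R `` {block_sum R x y}"
  unfolding mvn_monoid_def monoid.simps
  by (rule UN_equiv_class2[OF equiv_mvn_rel equiv_mvn_rel _ assms])
    (unfold congruent2_def, clarify, rule equiv_class_eq[OF equiv_mvn_rel block_sum_cong])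

lemma comm_monoid_mvn: "comm_monoid (mvn_monoid R)"
proof -
  have car: "X \<in> carrier (mvn_monoid R) \<longleftrightarrow> (\<exists>x\<in>projections R. X = mvn_rel R `` {x})" for X
    by (auto simp: mvn_monoid_def quotient_def)
  have cl: "mvn_rel R `` {x} \<in> carrier (mvn_monoid R)" if "x \<in> projections R" for x
    using that unfolding car by blast
  have one: "\<one>\<^bsub>mvn_monoid R\<^esub> = mvn_rel R `` {(1, \<lambda>_ _. \<zero>)}" by (simp add: mvn_monoid_def)
  note z = zero_projection[of 1, simplified]
  show ?thesis
  proof (rule comm_monoidI)
    fix X Y assume "X \<in> carrier (mvn_monoid R)" "Y \<in> carrier (mvn_monoid R)"
    then obtain x y where "x \<in> projections R" "y \<in> projections R" "X = mvn_rel R `` {x}" "Y = mvn_rel R `` {y}"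
      by (auto simp: car)
    moreover from this have "mvn_rel R `` {block_sum R x y} = mvn_rel R `` {block_sum R y x}"
      by (intro equiv_class_eq[OF equiv_mvn_rel] block_sum_comm)
    ultimately show "X \<otimes>\<^bsub>mvn_monoid R\<^esub> Y \<in> carrier (mvn_monoid R)"
      "X \<otimes>\<^bsub>mvn_monoid R\<^esub> Y = Y \<otimes>\<^bsub>mvn_monoid R\<^esub> X"
      by (simp_all add: mvn_mult cl block_sum_closed)
  next
    fix X Y Z
    assume "X \<in> carrier (mvn_monoid R)" "Y \<in> carrier (mvn_monoid R)" "Z \<in> carrier (mvn_monoid R)"
    then show "X \<otimes>\<^bsub>mvn_monoid R\<^esub> Y \<otimes>\<^bsub>mvn_monoid R\<^esub> Z = X \<otimes>\<^bsub>mvn_monoid R\<^esub> (Y \<otimes>\<^bsub>mvn_monoid R\<^esub> Z)"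
      by (auto simp: car mvn_mult block_sum_closed block_sum_assoc)
  next
    fix X assume "X \<in> carrier (mvn_monoid R)"
    then show "\<one>\<^bsub>mvn_monoid R\<^esub> \<otimes>\<^bsub>mvn_monoid R\<^esub> X = X"
      unfolding one using z equiv_class_eq[OF equiv_mvn_rel block_sum_zero] by (auto simp: car mvn_mult)
  next
    show "\<one>\<^bsub>mvn_monoid R\<^esub> \<in> carrier (mvn_monoid R)" by (simp add: one cl z)
  qed
qed

end

context comm_monoid
begin

lemma equiv_Grothendieck_rel: "equiv (carrier G \<times> carrier G) (Grothendieck_rel G)"
proof (rule equivI)
  show "Grothendieck_rel G \<subseteq> (carrier G \<times> carrier G) \<times> carrier G \<times> carrier G"
    by (auto simp: Grothendieck_rel_def)
  show "refl_on (carrier G \<times> carrier G) (Grothendieck_rel G)"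
    by (auto simp: refl_on_def Grothendieck_rel_def)
  show "sym (Grothendieck_rel G)"
    by (auto simp: sym_def Grothendieck_rel_def) metis
  show "trans (Grothendieck_rel G)"
  proof (rule transI, clarify)
    fix a b c d e f
    assume "((a, b), (c, d)) \<in> Grothendieck_rel G" "((c, d), (e, f)) \<in> Grothendieck_rel G"
    then obtain g h where c: "a \<in> carrier G" "b \<in> carrier G" "c \<in> carrier G" "d \<in> carrier G"
        "e \<in> carrier G" "f \<in> carrier G" "g \<in> carrier G" "h \<in> carrier G"
      and eq: "a \<otimes> d \<otimes> g = c \<otimes> b \<otimes> g" "c \<otimes> f \<otimes> h = e \<otimes> d \<otimes> h"
      by (auto simp: Grothendieck_rel_def)
    have "a \<otimes> f \<otimes> (d \<otimes> g \<otimes> h) = (a \<otimes> d \<otimes> g) \<otimes> (f \<otimes> h)" using c by (simp add: m_ac)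
    also have "\<dots> = (c \<otimes> f \<otimes> h) \<otimes> (b \<otimes> g)" unfolding eq(1) using c by (simp add: m_ac)
    also have "\<dots> = e \<otimes> b \<otimes> (d \<otimes> g \<otimes> h)" unfolding eq(2) using c by (simp add: m_ac)
    finally show "((a, b), (e, f)) \<in> Grothendieck_rel G"
      using c by (auto simp: Grothendieck_rel_def intro!: bexI[of _ "d \<otimes> g \<otimes> h"])
  qed
qed

lemma Grothendieck_rel_mult:
  assumes "((a, b), (a', b')) \<in> Grothendieck_rel G" "((c, d), (c', d')) \<in> Grothendieck_rel G"
  shows "((a \<otimes> c, b \<otimes> d), (a' \<otimes> c', b' \<otimes> d')) \<in> Grothendieck_rel G"
proof -
  obtain g h where c: "a \<in> carrier G" "b \<in> carrier G" "a' \<in> carrier G" "b' \<in> carrier G"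
      "c \<in> carrier G" "d \<in> carrier G" "c' \<in> carrier G" "d' \<in> carrier G" "g \<in> carrier G" "h \<in> carrier G"
    and eq: "a \<otimes> b' \<otimes> g = a' \<otimes> b \<otimes> g" "c \<otimes> d' \<otimes> h = c' \<otimes> d \<otimes> h"
    using assms by (auto simp: Grothendieck_rel_def)
  have "a \<otimes> c \<otimes> (b' \<otimes> d') \<otimes> (g \<otimes> h) = (a \<otimes> b' \<otimes> g) \<otimes> (c \<otimes> d' \<otimes> h)" using c by (simp add: m_ac)
  also have "\<dots> = a' \<otimes> c' \<otimes> (b \<otimes> d) \<otimes> (g \<otimes> h)" unfolding eq using c by (simp add: m_ac)
  finally show ?thesis using c by (auto simp: Grothendieck_rel_def intro!: bexI[of _ "g \<otimes> h"])
qed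

lemma Grothendieck_mult:
  assumes "a \<in> carrier G" "b \<in> carrier G" "c \<in> carrier G" "d \<in> carrier G"
  shows "Grothendieck_rel G `` {(a, b)} \<otimes>\<^bsub>Grothendieck_group G\<^esub> Grothendieck_rel G `` {(c, d)}
    = Grothendieck_rel G `` {(a \<otimes> c, b \<otimes> d)}"
proof -
  have "(\<lambda>x y. Grothendieck_rel G `` {(fst x \<otimes> fst y, snd x \<otimes> snd y)}) respects2 Grothendieck_rel G"
    unfolding congruent2_def using equiv_class_eq[OF equiv_Grothendieck_rel Grothendieck_rel_mult]
    by clarsimp
  from UN_equiv_class2[OF equiv_Grothendieck_rel equiv_Grothendieck_rel this, of "(a, b)" "(c, d)"]
  show ?thesis using assms by (simp add: Grothendieck_group_def)
qed

lemma comm_group_Grothendieck: "comm_group (Grothendieck_group G)"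
proof -
  let ?K = "Grothendieck_group G" and ?cl = "\<lambda>x. Grothendieck_rel G `` {x}"
  have car: "X \<in> carrier ?K \<longleftrightarrow> (\<exists>a\<in>carrier G. \<exists>b\<in>carrier G. X = ?cl (a, b))" for X
    by (auto simp: Grothendieck_group_def quotient_def)
  have cl: "?cl (a, b) \<in> carrier ?K" if "a \<in> carrier G" "b \<in> carrier G" for a b
    using that unfolding car by blast
  have one: "\<one>\<^bsub>?K\<^esub> = ?cl (\<one>, \<one>)" by (simp add: Grothendieck_group_def)
  have inv: "?cl (b \<otimes> a, a \<otimes> b) = ?cl (\<one>, \<one>)" if "a \<in> carrier G" "b \<in> carrier G" for a b
    using that by (intro equiv_class_eq[OF equiv_Grothendieck_rel])
      (auto simp: Grothendieck_rel_def m_ac intro!: bexI[of _ \<one>])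
  show ?thesis
  proof (rule comm_groupI)
    fix X assume "X \<in> carrier ?K"
    then obtain a b where "a \<in> carrier G" "b \<in> carrier G" "X = ?cl (a, b)" by (auto simp: car)
    then show "\<exists>Y\<in>carrier ?K. Y \<otimes>\<^bsub>?K\<^esub> X = \<one>\<^bsub>?K\<^esub>"
      by (intro bexI[of _ "?cl (b, a)"]) (simp_all add: cl Grothendieck_mult one inv)
  next
    fix X Y assume "X \<in> carrier ?K" "Y \<in> carrier ?K"
    then obtain a b c d where "a \<in> carrier G" "b \<in> carrier G" "X = ?cl (a, b)"
      "c \<in> carrier G" "d \<in> carrier G" "Y = ?cl (c, d)" by (auto simp: car)
    then show "X \<otimes>\<^bsub>?K\<^esub> Y \<in> carrier ?K" "X \<otimes>\<^bsub>?K\<^esub> Y = Y \<otimes>\<^bsub>?K\<^esub> X"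
      by (simp_all add: cl Grothendieck_mult m_comm)
  next
    fix X Y Z assume "X \<in> carrier ?K" "Y \<in> carrier ?K" "Z \<in> carrier ?K"
    then obtain a b c d e f where "a \<in> carrier G" "b \<in> carrier G" "X = ?cl (a, b)"
      "c \<in> carrier G" "d \<in> carrier G" "Y = ?cl (c, d)"
      "e \<in> carrier G" "f \<in> carrier G" "Z = ?cl (e, f)" by (auto simp: car)
    then show "X \<otimes>\<^bsub>?K\<^esub> Y \<otimes>\<^bsub>?K\<^esub> Z = X \<otimes>\<^bsub>?K\<^esub> (Y \<otimes>\<^bsub>?K\<^esub> Z)"
      by (simp add: Grothendieck_mult m_assoc)
  next
    fix X assume "X \<in> carrier ?K"
    then show "\<one>\<^bsub>?K\<^esub> \<otimes>\<^bsub>?K\<^esub> X = X" by (auto simp: car Grothendieck_mult one)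
  next
    show "\<one>\<^bsub>?K\<^esub> \<in> carrier ?K" by (simp add: one cl)
  qed
qed

end

theorem (in star_ring) comm_group_K0: "comm_group (K0 R)"
  unfolding K0_def by (rule comm_monoid.comm_group_Grothendieck[OF comm_monoid_mvn])

lemma (in star_ring) K0_class_closed:
  assumes "p \<in> carrier R" "star R p = p" "p \<otimes> p = p"
  shows "K0_class R p \<in> carrier (K0 R)"
proof -
  let ?M = "mvn_monoid R" and ?P = "\<lambda>i j. if i = (0::nat) \<and> j = (0::nat) then p else \<zero>"
  interpret M: comm_monoid ?M by (rule comm_monoid_mvn)
  have "(1, ?P) \<in> projections R"
    using assms by (auto simp: projections_def mats_def mat_star_def mat_prod_def fun_eq_iff lessThan_Suc)
  then have "mvn_rel R `` {(1, ?P)} \<in> carrier ?M" by (auto simp: mvn_monoid_def quotient_def)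
  then show ?thesis
    unfolding K0_class_def K0_def Grothendieck_group_def by (auto intro!: quotientI)
qed

lemma star_ring_cont_fun_alg: "star_ring (cont_fun_alg X)"
proof -
  let ?A = "cont_fun_alg X"
  have cont [simp]: "continuous_map X euclidean (\<lambda>x\<in>topspace X. f x) \<longleftrightarrow> continuous_map X euclidean f"
    for f :: "'a \<Rightarrow> complex"
    by (rule iffI; erule continuous_map_eq) auto
  have mult: "continuous_map X euclidean (\<lambda>x. f x * g x)"
    if "continuous_map X euclidean f" "continuous_map X euclidean g" for f g :: "'a \<Rightarrow> complex"
    using that by (simp add: continuous_map_atin tendsto_mult)
  have cnj: "continuous_map X euclidean (\<lambda>x. cnj (f x))"
    if "continuous_map X euclidean f" for f :: "'a \<Rightarrow> complex"
    using that by (simp add: continuous_map_atin tendsto_cnj)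
  have ext: "f = g \<longleftrightarrow> (\<forall>x\<in>topspace X. f x = g x)"
    if "f \<in> extensional (topspace X)" "g \<in> extensional (topspace X)" for f g :: "'a \<Rightarrow> complex"
    using that by (auto intro: extensionalityI)
  have ab: "abelian_group ?A"
  proof (rule abelian_groupI)
    fix f assume "f \<in> carrier ?A"
    then show "\<exists>g\<in>carrier ?A. g \<oplus>\<^bsub>?A\<^esub> f = \<zero>\<^bsub>?A\<^esub>"
      by (intro bexI[of _ "\<lambda>x\<in>topspace X. - f x"]) (auto simp: cont_fun_alg_def ext)
  qed (auto simp: cont_fun_alg_def ext algebra_simps intro: continuous_map_add)
  have mon: "monoid ?A"
    by (rule monoidI) (auto simp: cont_fun_alg_def ext algebra_simps intro: mult)
  have ring: "ring ?A"
    by (rule ringI[OF ab mon]) (auto simp: cont_fun_alg_def ext algebra_simps)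
  show ?thesis
    by (rule star_ring.intro[OF ring], unfold_locales) (auto simp: cont_fun_alg_def ext intro: cnj)
qed

end

theory Submission
  imports Defs
begin

text \<open>
  A projection \<open>p\<close> over \<open>C(X)\<close> is dismantled by induction on a bound for its pointwise trace. The open
  sets \<open>{tr p < 1}\<close>, on which \<open>p\<close> vanishes, and \<open>{p\<^sub>i\<^sub>i > 0}\<close> cover \<open>X\<close>. If \<open>X\<close> is a compact Vilenkin
  group, the cosets of some \<open>G\<^sub>r\<close> form a finite clopen partition subordinate to this cover, and \<open>p\<close> is
  the orthogonal sum of its cut-offs \<open>1\<^sub>C p\<close> to these cosets. On a coset \<open>C\<close> where \<open>p\<^sub>i\<^sub>i > 0\<close>, the
  column \<open>v = 1\<^sub>C p e\<^sub>i / \<surd>p\<^sub>i\<^sub>i\<close> satisfies \<open>v\<^sup>*v = 1\<^sub>C\<close> and \<open>vv\<^sup>* \<le> 1\<^sub>C p\<close>, so splitting off \<open>vv\<^sup>*\<close>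
  contributes the generator \<open>[1\<^sub>C]\<close> and lowers the trace by one on \<open>C\<close>.
\<close>

section \<open>Addition and equality of projection classes over a ring with involution\<close>

section \<open>Classes of projections in \<open>K\<^sub>0\<close>\<close>

text \<open>The formal difference \<open>[x] - [0]\<close> for a projection of any matrix size;
  \<open>K0_class\<close> is its value on \<open>1 \<times> 1\<close> matrices.\<close>

definition projection_class :: "('a, 'm) star_ring_scheme \<Rightarrow> nat \<times> (nat \<Rightarrow> nat \<Rightarrow> 'a) \<Rightarrow>
    ((nat \<times> (nat \<Rightarrow> nat \<Rightarrow> 'a)) set \<times> (nat \<times> (nat \<Rightarrow> nat \<Rightarrow> 'a)) set) set" where
  "projection_class R x = Grothendieck_rel (mvn_monoid R) `` {(mvn_rel R `` {x}, \<one>\<^bsub>mvn_monoid R\<^esub>)}"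

context star_ring
begin

lemma mvn_class_closed: "x \<in> projections R \<Longrightarrow> mvn_rel R `` {x} \<in> carrier (mvn_monoid R)"
  by (auto simp: mvn_monoid_def quotient_def)

lemma projection_class_closed:
  assumes "x \<in> projections R"
  shows "projection_class R x \<in> carrier (K0 R)"
proof -
  interpret M: comm_monoid "mvn_monoid R" by (rule comm_monoid_mvn)
  show ?thesis
    using mvn_class_closed[OF assms]
    by (auto simp: projection_class_def K0_def Grothendieck_group_def intro!: quotientI)
qed

lemma projection_class_eqI: "(x, y) \<in> mvn_rel R \<Longrightarrow> projection_class R x = projection_class R y"
  unfolding projection_class_def using equiv_class_eq[OF equiv_mvn_rel] by metis

lemma projection_class_block_sum:
  assumes "x \<in> projections R" "y \<in> projections R"
  shows "projection_class R (block_sum R x y) = projection_class R x \<otimes>\<^bsub>K0 R\<^esub> projection_class R y"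
proof -
  interpret M: comm_monoid "mvn_monoid R" by (rule comm_monoid_mvn)
  show ?thesis
    using assms unfolding projection_class_def K0_def
    by (simp add: M.Grothendieck_mult mvn_class_closed mvn_mult)
qed

lemma projection_class_zero:
  assumes "n \<ge> 1"
  shows "projection_class R (n, \<lambda>_ _. \<zero>) = \<one>\<^bsub>K0 R\<^esub>"
proof -
  have "((n, \<lambda>_ _. \<zero>), (1, \<lambda>_ _. \<zero>)) \<in> mvn_rel R"
    using assms zero_projection
    by (intro mvn_relI[where v = "\<lambda>_ _. \<zero>"]) (auto simp: mats_def mat_prod_def mat_star_def)
  then have "projection_class R (n, \<lambda>_ _. \<zero>) = projection_class R (1, \<lambda>_ _. \<zero>)"
    by (rule projection_class_eqI)
  then show ?thesis
    by (simp add: projection_class_def K0_def Grothendieck_group_def mvn_monoid_def)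
qed

text \<open>The column \<open>v\<close> is itself the partial isometry between the
  \<open>1 \<times> 1\<close> projection \<open>e\<close> and \<open>p\<close>. A matrix in
  \<open>mats R 1 1\<close> is determined by its entry at \<open>0 0\<close>, so
  \<open>v\<^sup>*v\<close> is checked there only.\<close>

lemma projection_class_rank_one:
  assumes p: "(n, p) \<in> projections R" and e: "e \<in> carrier R" "star R e = e" "e \<otimes> e = e"
    and v: "v \<in> mats R n 1" "mat_prod R n (mat_star R v) v 0 0 = e"
    "p = mat_prod R 1 v (mat_star R v)"
  shows "projection_class R (n, p) = K0_class R e"
proof -
  let ?E = "\<lambda>i j. if i = (0::nat) \<and> j = (0::nat) then e else \<zero>"
  have E: "(1, ?E) \<in> projections R"
    using e by (auto simp: projections_def mats_def mat_star_def mat_prod_def fun_eq_iff lessThan_Suc)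
  have "mat_prod R n (mat_star R v) v \<in> mats R 1 1"
    by (rule mat_prod_closed[OF mat_star_closed[OF v(1)] v(1)])
  then have "?E = mat_prod R n (mat_star R v) v"
    using v(2) by (intro ext) (auto simp: mats_def)
  then have "((1, ?E), (n, p)) \<in> mvn_rel R"
    by (intro mvn_relI[OF E p v(1)] v(3))
  from projection_class_eqI[OF this] show ?thesis
    by (simp add: projection_class_def K0_class_def)
qed

text \<open>The column \<open>v = (p, q)\<close> satisfies \<open>v\<^sup>*v = p + q\<close> and \<open>vv\<^sup>* = diag(p, q)\<close>.\<close>

lemma projection_class_orthogonal_sum:
  assumes p: "(n, p) \<in> projections R" and q: "(n, q) \<in> projections R"
    and s: "(n, \<lambda>i j. p i j \<oplus> q i j) \<in> projections R"
    and pq: "\<And>i j. mat_prod R n p q i j = \<zero>"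
  shows "projection_class R (n, \<lambda>i j. p i j \<oplus> q i j)
    = projection_class R (n, p) \<otimes>\<^bsub>K0 R\<^esub> projection_class R (n, q)"
proof -
  note pD = projectionsD[OF p] and qD = projectionsD[OF q]
  note [simp] = matsD[OF pD(2)] matsD[OF qD(2)]
  have stp: "star R (p i j) = p j i" and stq: "star R (q i j) = q j i" for i j
    using fun_cong[OF fun_cong[OF pD(3), of j], of i] fun_cong[OF fun_cong[OF qD(3), of j], of i]
    by (simp_all add: mat_star_def)
  have pp: "(\<Oplus>h\<in>{..<n}. p i h \<otimes> p h j) = p i j" and qq: "(\<Oplus>h\<in>{..<n}. q i h \<otimes> q h j) = q i j" for i j
    using fun_cong[OF fun_cong[OF pD(4), of i], of j] fun_cong[OF fun_cong[OF qD(4), of i], of j]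
    by (simp_all add: mat_prod_def)
  have pq': "(\<Oplus>h\<in>{..<n}. p i h \<otimes> q h j) = \<zero>" for i j
    using pq[of i j] by (simp add: mat_prod_def)
  \<comment> \<open>The off-diagonal blocks of \<open>vv\<^sup>*\<close> are \<open>pq\<close> and
    \<open>qp\<close>; the second vanishes because it is the adjoint of the first.\<close>
  have qp: "(\<Oplus>h\<in>{..<n}. q i h \<otimes> p h j) = \<zero>" for i j
  proof -
    have "star R (\<Oplus>h\<in>{..<n}. p j h \<otimes> q h i) = (\<Oplus>h\<in>{..<n}. q i h \<otimes> p h j)"
      by (subst star_finsum) (auto simp: star_mult stp stq)
    then show ?thesis by (simp add: pq')
  qed
  define v where "v = (\<lambda>i j. if i < n then p i j else q (i - n) j)"
  have [simp]: "v i j \<in> carrier R" for i j by (simp add: v_def)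
  have v: "v \<in> mats R (n + n) n"
    unfolding mats_def v_def using mats_zero[OF pD(2)] mats_zero[OF qD(2)]
    by (auto intro: mats_zero[OF qD(2)])
  have un: "{..<n + n} = {..<n} \<union> (+) n ` {..<n}"
    by (simp only: lessThan_atLeast0 image_add_atLeastLessThan add_0_right) auto
  have "((n, \<lambda>i j. p i j \<oplus> q i j), block_sum R (n, p) (n, q)) \<in> mvn_rel R"
    unfolding block_sum_def prod.case
  proof (rule mvn_relI[OF s _ v])
    show "(n + n, block_diag R n n p q) \<in> projections R"
      using block_sum_closed[OF p q] by (simp add: block_sum_def)
    show "(\<lambda>i j. p i j \<oplus> q i j) = mat_prod R (n + n) (mat_star R v) v"
    proof (intro ext)
      fix i j
      have "(\<Oplus>h\<in>{..<n + n}. star R (v h i) \<otimes> v h j)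
        = (\<Oplus>h\<in>{..<n}. star R (v h i) \<otimes> v h j) \<oplus> (\<Oplus>h\<in>(+) n ` {..<n}. star R (v h i) \<otimes> v h j)"
        unfolding un by (rule finsum_Un_disjoint) auto
      also have "(\<Oplus>h\<in>(+) n ` {..<n}. star R (v h i) \<otimes> v h j)
        = (\<Oplus>h\<in>{..<n}. star R (v (n + h) i) \<otimes> v (n + h) j)"
        by (rule finsum_reindex) auto
      also have "\<dots> = (\<Oplus>h\<in>{..<n}. q i h \<otimes> q h j)"
        by (rule finsum_cong') (auto simp: v_def stq)
      also have "(\<Oplus>h\<in>{..<n}. star R (v h i) \<otimes> v h j) = (\<Oplus>h\<in>{..<n}. p i h \<otimes> p h j)"
        by (rule finsum_cong') (auto simp: v_def stp)
      finally show "p i j \<oplus> q i j = mat_prod R (n + n) (mat_star R v) v i j"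
        by (simp add: mat_prod_def mat_star_def pp qq)
    qed
    show "block_diag R n n p q = mat_prod R n v (mat_star R v)"
      using mats_zero[OF pD(2)] mats_zero[OF qD(2)]
      by (intro ext) (auto simp: mat_prod_def mat_star_def block_diag_def v_def stp stq pp qq pq' qp)
  qed
  from projection_class_eqI[OF this] show ?thesis
    by (simp add: projection_class_block_sum p q)
qed

text \<open>Every element of a Grothendieck group is a difference of two classes from the monoid, so
  a subgroup containing the classes of all projections exhausts \<open>K0 R\<close>.\<close>

lemma K0_carrier_eq_subgroup:
  assumes H: "subgroup H (K0 R)" and cl: "\<And>x. x \<in> projections R \<Longrightarrow> projection_class R x \<in> H"
  shows "H = carrier (K0 R)"
proof
  interpret M: comm_monoid "mvn_monoid R" by (rule comm_monoid_mvn)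
  interpret K: comm_group "K0 R" by (rule comm_group_K0)
  show "H \<subseteq> carrier (K0 R)" by (rule subgroup.subset[OF H])
  show "carrier (K0 R) \<subseteq> H"
  proof
    fix X assume "X \<in> carrier (K0 R)"
    then obtain x y where xy: "x \<in> projections R" "y \<in> projections R"
      and X: "X = Grothendieck_rel (mvn_monoid R) `` {(mvn_rel R `` {x}, mvn_rel R `` {y})}"
      by (auto simp: K0_def Grothendieck_group_def quotient_def mvn_monoid_def)
    \<comment> \<open>The left side is the class of the pair \<open>(x + y, y)\<close>, related to
      \<open>(x, 0)\<close> with the neutral element as the cancelling summand.\<close>
    have "X \<otimes>\<^bsub>K0 R\<^esub> projection_class R y = projection_class R x"
      unfolding X projection_class_def K0_def
      using mvn_class_closed[OF xy(1)] mvn_class_closed[OF xy(2)]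
      by (simp add: M.Grothendieck_mult)
        (intro equiv_class_eq[OF M.equiv_Grothendieck_rel],
          auto simp: Grothendieck_rel_def M.m_ac intro!: bexI[of _ "\<one>\<^bsub>mvn_monoid R\<^esub>"])
    then have "X = projection_class R x \<otimes>\<^bsub>K0 R\<^esub> inv\<^bsub>K0 R\<^esub> projection_class R y"
      using \<open>X \<in> carrier (K0 R)\<close> xy by (metis K.inv_solve_right projection_class_closed)
    then show "X \<in> H"
      using cl xy H by (simp add: subgroup.m_closed subgroup.m_inv_closed)
  qed
qed

end

section \<open>Linear algebra of a single complex projection matrix\<close>

section \<open>Complex projection matrices\<close>

text \<open>The equations are required at all indices, not only below \<open>n\<close>, so that they
  can be used without bounds. This costs nothing for matrices from \<open>mats\<close>, whose
  entries vanish beyond \<open>n\<close>.\<close>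

definition complex_projection :: "nat \<Rightarrow> (nat \<Rightarrow> nat \<Rightarrow> complex) \<Rightarrow> bool" where
  "complex_projection n P \<longleftrightarrow>
    (\<forall>i j. cnj (P j i) = P i j) \<and> (\<forall>i j. (\<Sum>l<n. P i l * P l j) = P i j)"

definition real_trace :: "nat \<Rightarrow> (nat \<Rightarrow> nat \<Rightarrow> complex) \<Rightarrow> real" where
  "real_trace n P = (\<Sum>i<n. Re (P i i))"

text \<open>For a projection \<open>P\<close> with \<open>P i i \<noteq> 0\<close>, the subtracted
  matrix is the orthogonal projection onto the line spanned by column \<open>i\<close> of
  \<open>P\<close>, a vector of squared norm \<open>P i i\<close>.\<close>

definition deflate :: "nat \<Rightarrow> (nat \<Rightarrow> nat \<Rightarrow> complex) \<Rightarrow> nat \<Rightarrow> nat \<Rightarrow> complex" where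
  "deflate i P = (\<lambda>j k. P j k - P j i * P i k / P i i)"

text \<open>This is \<open>P = P P\<^sup>*\<close> read on the diagonal: \<open>P i i\<close> is the
  squared norm of row \<open>i\<close>.\<close>

lemma complex_projection_diag:
  assumes "complex_projection n P"
  shows "P i i = of_real (\<Sum>l<n. (norm (P i l))\<^sup>2)"
proof -
  have "P i i = (\<Sum>l<n. P i l * P l i)" using assms by (simp add: complex_projection_def)
  also have "\<dots> = (\<Sum>l<n. of_real ((norm (P i l))\<^sup>2))"
  proof (rule sum.cong)
    fix l
    have "P l i = cnj (P i l)" using assms by (simp add: complex_projection_def)
    then show "P i l * P l i = of_real ((norm (P i l))\<^sup>2)" by (metis complex_norm_square of_real_power)
  qed simp
  finally show ?thesis by simp
qed

lemma complex_projection_diag_Re: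
  assumes "complex_projection n P"
  shows "P i i = of_real (Re (P i i))" "0 \<le> Re (P i i)"
proof -
  have d: "Re (P i i) = (\<Sum>l<n. (norm (P i l))\<^sup>2)"
    by (subst complex_projection_diag[OF assms]) simp
  show "P i i = of_real (Re (P i i))" unfolding d by (rule complex_projection_diag[OF assms])
  show "0 \<le> Re (P i i)" unfolding d by (simp add: sum_nonneg)
qed

text \<open>With \<open>d = P i i\<close>, the square of \<open>d\<close> is one of the summands in
  the squared norm of row \<open>i\<close>, which is \<open>d\<close>. Hence
  \<open>d * d \<le> d\<close>.\<close>

lemma complex_projection_diag_le_1:
  assumes "complex_projection n P" "i < n"
  shows "Re (P i i) \<le> 1"
proof -
  let ?d = "Re (P i i)"
  have "(norm (P i i))\<^sup>2 \<le> (\<Sum>l<n. (norm (P i l))\<^sup>2)"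
    by (rule member_le_sum) (use assms in auto)
  also have "\<dots> = ?d" by (subst complex_projection_diag[OF assms(1)]) simp
  finally have "?d\<^sup>2 \<le> ?d"
    using complex_projection_diag_Re[OF assms(1), of i] by (metis norm_of_real power2_abs)
  then have "?d * ?d \<le> ?d * 1" by (simp add: power2_eq_square)
  then show ?thesis
    using complex_projection_diag_Re(2)[OF assms(1), of i] by (cases "?d = 0") auto
qed

lemma complex_projection_zero:
  assumes "complex_projection n P" "Re (P i i) = 0" "j < n"
  shows "P i j = 0"
proof -
  have "(\<Sum>l<n. (norm (P i l))\<^sup>2) = 0"
    using assms(2) complex_projection_diag[OF assms(1), of i]
    by (metis Re_complex_of_real)
  then show ?thesis using assms(3) by (simp add: sum_nonneg_eq_0_iff)
qed

text \<open>Let \<open>Q\<close> be the deflated matrix. It satisfies \<open>P Q = Q\<close> and its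
  row \<open>i\<close> is zero. Therefore row \<open>i\<close> of \<open>P Q\<close> is zero, the
  subtracted rank one matrix annihilates \<open>Q\<close>, and \<open>Q Q = P Q = Q\<close>. That
  rank one matrix has trace \<open>(P P) i i / P i i = 1\<close>.\<close>

lemma deflate_complex_projection:
  assumes P: "complex_projection n P" and d: "P i i \<noteq> 0"
  shows "complex_projection n (deflate i P)"
    and "(\<Sum>l<n. P j i * P i l * deflate i P l k) = 0"
    and "real_trace n (deflate i P) = real_trace n P - 1"
proof -
  have h: "cnj (P j k) = P k j" and s: "(\<Sum>l<n. P j l * P l k) = P j k" for j k
    using P by (auto simp: complex_projection_def)
  \<comment> \<open>\<open>P\<close> fixes its own columns, and the columns of the deflated matrix
    are combinations of these.\<close>
  have col: "(\<Sum>l<n. P j l * deflate i P l k) = deflate i P j k" for j k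
  proof -
    have "(\<Sum>l<n. P j l * deflate i P l k)
        = (\<Sum>l<n. P j l * P l k) - (\<Sum>l<n. P j l * P l i) * (P i k / P i i)"
      by (simp add: deflate_def right_diff_distrib sum_subtractf sum_distrib_right sum_divide_distrib mult.assoc)
    then show ?thesis by (simp add: s deflate_def)
  qed
  have row0: "deflate i P i k = 0" for k using d by (simp add: deflate_def)
  have orth: "(\<Sum>l<n. c * P i l * deflate i P l k) = 0" for c k
    using col[of i k] by (simp add: mult.assoc sum_distrib_left[symmetric] row0)
  then show "(\<Sum>l<n. P j i * P i l * deflate i P l k) = 0" .
  have "(\<Sum>l<n. deflate i P j l * deflate i P l k) = deflate i P j k" for j k
  proof -
    have "(\<Sum>l<n. deflate i P j l * deflate i P l k)
      = (\<Sum>l<n. (P j l - (P j i / P i i) * P i l) * deflate i P l k)"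
      by (simp add: deflate_def)
    also have "\<dots>
      = (\<Sum>l<n. P j l * deflate i P l k) - (\<Sum>l<n. (P j i / P i i) * P i l * deflate i P l k)"
      by (simp add: left_diff_distrib sum_subtractf)
    finally have "(\<Sum>l<n. deflate i P j l * deflate i P l k) = \<dots>" .
    then show ?thesis by (simp only: col orth diff_zero)
  qed
  then show "complex_projection n (deflate i P)"
    using h by (simp add: complex_projection_def) (simp add: deflate_def mult.commute)
  have "(\<Sum>j<n. P j i * P i j / P i i) = (\<Sum>j<n. P i j * P j i) / P i i"
    by (simp add: sum_divide_distrib mult.commute)
  also have "\<dots> = 1" using d by (simp add: s)
  finally have "(\<Sum>j<n. Re (P j i * P i j / P i i)) = 1"
    by (metis Re_sum one_complex.sel(1))
  then show "real_trace n (deflate i P) = real_trace n P - 1"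
    by (simp add: real_trace_def deflate_def sum_subtractf)
qed

lemma real_trace_nonneg: "complex_projection n P \<Longrightarrow> 0 \<le> real_trace n P"
  by (simp add: real_trace_def sum_nonneg complex_projection_diag_Re(2))

text \<open>A nonzero diagonal entry would allow a deflation, producing a projection of negative
  trace. So the diagonal is zero, and each row vanishes with its diagonal entry.\<close>

lemma real_trace_less_1:
  assumes P: "complex_projection n P" and tr: "real_trace n P < 1" and ij: "i < n" "j < n"
  shows "P i j = 0"
proof (rule complex_projection_zero[OF P _ ij(2)], rule ccontr)
  assume "Re (P i i) \<noteq> 0"
  then have "P i i \<noteq> 0" by auto
  from real_trace_nonneg[OF deflate_complex_projection(1)[OF P this]]
  show False using deflate_complex_projection(3)[OF P \<open>P i i \<noteq> 0\<close>] tr by simp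
qed

section \<open>Pointwise description of projections over \<open>C(X)\<close>\<close>

section \<open>Matrices over \<open>C(X)\<close>\<close>

lemma cont_fun_alg_simps:
  "f \<in> carrier (cont_fun_alg X) \<longleftrightarrow> f \<in> extensional (topspace X) \<and> continuous_map X euclidean f"
  "\<zero>\<^bsub>cont_fun_alg X\<^esub> = (\<lambda>x\<in>topspace X. 0)"
  "f \<oplus>\<^bsub>cont_fun_alg X\<^esub> g = (\<lambda>x\<in>topspace X. f x + g x)"
  "f \<otimes>\<^bsub>cont_fun_alg X\<^esub> g = (\<lambda>x\<in>topspace X. f x * g x)"
  "star (cont_fun_alg X) f = (\<lambda>x\<in>topspace X. cnj (f x))"
  by (auto simp: cont_fun_alg_def)

lemma cont_fun_alg_restrict:
  "continuous_map X euclidean f \<Longrightarrow> (\<lambda>x\<in>topspace X. f x) \<in> carrier (cont_fun_alg X)"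
  by (auto simp: cont_fun_alg_simps intro: continuous_map_eq)

text \<open>Passing to limits makes the \<open>tendsto\<close> rules for products, quotients and
  square roots available for functions on an abstract topology.\<close>

lemma continuous_map_complexI:
  fixes f :: "'a \<Rightarrow> complex"
  assumes "\<And>x. x \<in> topspace X \<Longrightarrow> (f \<longlongrightarrow> f x) (atin X x)"
  shows "continuous_map X euclidean f"
  using assms by (simp add: continuous_map_atin)

lemma cont_fun_alg_tendsto:
  "f \<in> carrier (cont_fun_alg X) \<Longrightarrow> x \<in> topspace X \<Longrightarrow> (f \<longlongrightarrow> f x) (atin X x)"
  by (simp add: cont_fun_alg_simps continuous_map_atin)

text \<open>The indicator is locally constant: either \<open>C\<close> or its complement is a
  neighbourhood of \<open>x\<close> on which it does not change.\<close>

lemma tendsto_indicator_clopen: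
  assumes "openin X C" "closedin X C" "x \<in> topspace X"
  shows "((indicator C :: 'a \<Rightarrow> complex) \<longlongrightarrow> indicator C x) (atin X x)"
proof (rule tendsto_eventually, cases "x \<in> C")
  case True
  then show "\<forall>\<^sub>F y in atin X x. indicator C y = (indicator C x :: complex)"
    using assms by (auto simp: eventually_atin intro!: exI[of _ C])
next
  case False
  then show "\<forall>\<^sub>F y in atin X x. indicator C y = (indicator C x :: complex)"
    using assms by (auto simp: eventually_atin closedin_def intro!: exI[of _ "topspace X - C"])
qed

lemma cont_fun_alg_finsum:
  assumes "finite F" "\<And>i. i \<in> F \<Longrightarrow> f i \<in> carrier (cont_fun_alg X)" "x \<in> topspace X"
  shows "finsum (cont_fun_alg X) f F x = (\<Sum>i\<in>F. f i x)"
proof -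
  interpret star_ring "cont_fun_alg X" by (rule star_ring_cont_fun_alg)
  show ?thesis
    using assms(1,2)
    by (induction F rule: finite_induct) (use assms(3) in \<open>auto simp: cont_fun_alg_simps(2,3) Pi_iff\<close>)
qed

lemma cont_fun_alg_ext:
  assumes "f \<in> carrier (cont_fun_alg X)" "g \<in> carrier (cont_fun_alg X)"
    "\<And>x. x \<in> topspace X \<Longrightarrow> f x = g x"
  shows "f = g"
  using assms by (intro extensionalityI[of f "topspace X" g]) (auto simp: cont_fun_alg_simps(1))

lemma cont_fun_mat_ext:
  assumes "v \<in> mats (cont_fun_alg X) m n" "w \<in> mats (cont_fun_alg X) m' n'"
    "\<And>i j x. x \<in> topspace X \<Longrightarrow> v i j x = w i j x"
  shows "v = w"
  using assms by (intro ext cont_fun_alg_ext[of _ X]) (auto simp: mats_def)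

lemma cont_fun_mat_prod:
  assumes "v \<in> mats (cont_fun_alg X) m k" "w \<in> mats (cont_fun_alg X) k' n" "x \<in> topspace X"
  shows "mat_prod (cont_fun_alg X) h v w i j x = (\<Sum>l<h. v i l x * w l j x)"
proof -
  interpret star_ring "cont_fun_alg X" by (rule star_ring_cont_fun_alg)
  show ?thesis
    unfolding mat_prod_def using assms(3) matsD[OF assms(1)] matsD[OF assms(2)]
    by (subst cont_fun_alg_finsum) (auto simp: cont_fun_alg_simps(4)[symmetric], simp add: cont_fun_alg_simps(4))
qed

text \<open>Adjoints and products of matrices over \<open>C(X)\<close> are computed pointwise, so
  all later verifications reduce to complex matrices at a single point.\<close>

lemma cont_fun_projections_iff:
  "(n, p) \<in> projections (cont_fun_alg X) \<longleftrightarrow> n \<ge> 1 \<and> p \<in> mats (cont_fun_alg X) n n \<and>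
    (\<forall>x\<in>topspace X. complex_projection n (\<lambda>i j. p i j x))" (is "?L \<longleftrightarrow> ?R")
proof -
  let ?A = "cont_fun_alg X"
  interpret star_ring ?A by (rule star_ring_cont_fun_alg)
  have st: "mat_star ?A p i j x = cnj (p j i x)" if "x \<in> topspace X" for i j x
    using that by (simp add: mat_star_def cont_fun_alg_simps)
  show ?thesis
  proof
    assume ?L
    note D = projectionsD[OF this]
    have "cnj (p j i x) = p i j x" if "x \<in> topspace X" for i j x
      using st[OF that, of i j] D(3) by simp
    moreover have "(\<Sum>l<n. p i l x * p l j x) = p i j x" if "x \<in> topspace X" for i j x
      using cont_fun_mat_prod[OF D(2) D(2) that, of n i j] D(4) by simp
    ultimately show ?R using D by (auto simp: complex_projection_def)
  next
    assume R: ?R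
    then have p: "p \<in> mats ?A n n" by simp
    have "mat_star ?A p = p"
      by (rule cont_fun_mat_ext[OF mat_star_closed[OF p] p])
        (use R in \<open>auto simp: st complex_projection_def\<close>)
    moreover have "mat_prod ?A n p p = p"
      by (rule cont_fun_mat_ext[OF mat_prod_closed[OF p p] p])
        (use R in \<open>auto simp: cont_fun_mat_prod[OF p p] complex_projection_def\<close>)
    ultimately show ?L using R by (simp add: projections_def)
  qed
qed

section \<open>Cut-offs to clopen sets and splitting off a rank one projection\<close>

definition cut_off :: "'a topology \<Rightarrow> 'a set \<Rightarrow> (nat \<Rightarrow> nat \<Rightarrow> 'a \<Rightarrow> complex) \<Rightarrow> nat \<Rightarrow> nat \<Rightarrow> 'a \<Rightarrow> complex" where
  "cut_off X C p = (\<lambda>i j. \<lambda>x\<in>topspace X. indicator C x * p i j x)"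

lemma cut_off_mats:
  assumes p: "p \<in> mats (cont_fun_alg X) m n" and C: "openin X C" "closedin X C"
  shows "cut_off X C p \<in> mats (cont_fun_alg X) m n"
proof -
  have "(\<lambda>x\<in>topspace X. indicator C x * p i j x) \<in> carrier (cont_fun_alg X)" for i j
    by (intro cont_fun_alg_restrict continuous_map_complexI tendsto_mult
        tendsto_indicator_clopen[OF C] cont_fun_alg_tendsto) (use p in \<open>auto simp: mats_def\<close>)
  then show ?thesis using p by (auto simp: mats_def cut_off_def cont_fun_alg_simps(2) fun_eq_iff)
qed

lemma cut_off_projection:
  assumes p: "(n, p) \<in> projections (cont_fun_alg X)" and C: "openin X C" "closedin X C"
  shows "(n, cut_off X C p) \<in> projections (cont_fun_alg X)"
proof -
  have "complex_projection n (\<lambda>i j. cut_off X C p i j x)" if "x \<in> topspace X" for x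
    using p that
    by (auto simp: cont_fun_projections_iff complex_projection_def cut_off_def indicator_def)
  then show ?thesis
    using p cut_off_mats[OF _ C] by (auto simp: cont_fun_projections_iff)
qed

lemma projection_class_zero_on:
  assumes p: "(n, p) \<in> projections (cont_fun_alg X)"
    and 0: "\<And>i j x. i < n \<Longrightarrow> j < n \<Longrightarrow> x \<in> topspace X \<Longrightarrow> p i j x = 0"
  shows "projection_class (cont_fun_alg X) (n, p) = \<one>\<^bsub>K0 (cont_fun_alg X)\<^esub>"
proof -
  let ?A = "cont_fun_alg X"
  interpret star_ring ?A by (rule star_ring_cont_fun_alg)
  have m: "n \<ge> 1" "p \<in> mats ?A n n" using p by (auto simp: cont_fun_projections_iff)
  have "p i j x = 0" if "x \<in> topspace X" for i j x
    using 0[OF _ _ that, of i j] mats_zero[OF m(2), of i j] that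
    by (cases "i < n \<and> j < n") (auto simp: cont_fun_alg_simps(2))
  then have "p = (\<lambda>_ _. \<zero>\<^bsub>?A\<^esub>)"
    by (intro cont_fun_mat_ext[OF m(2), of _ n n]) (auto simp: mats_def cont_fun_alg_simps(2) intro: cont_fun_alg_restrict)
  then show ?thesis using projection_class_zero[OF m(1)] by simp
qed

text \<open>Cut-offs to disjoint sets are orthogonal, because at each point one factor vanishes, and
  their sum is the cut-off to the union.\<close>

lemma cut_off_Un:
  assumes p: "(n, p) \<in> projections (cont_fun_alg X)" and C: "openin X C" "closedin X C"
    and D: "openin X D" "closedin X D" and "C \<inter> D = {}"
  shows "projection_class (cont_fun_alg X) (n, cut_off X (C \<union> D) p)
    = projection_class (cont_fun_alg X) (n, cut_off X C p)
      \<otimes>\<^bsub>K0 (cont_fun_alg X)\<^esub> projection_class (cont_fun_alg X) (n, cut_off X D p)"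
proof -
  let ?A = "cont_fun_alg X"
  interpret star_ring ?A by (rule star_ring_cont_fun_alg)
  have eq: "cut_off X (C \<union> D) p = (\<lambda>i j. cut_off X C p i j \<oplus>\<^bsub>?A\<^esub> cut_off X D p i j)"
    using \<open>C \<inter> D = {}\<close>
    by (auto simp: cut_off_def cont_fun_alg_simps fun_eq_iff indicator_def)
  have m: "p \<in> mats ?A n n" using p by (simp add: cont_fun_projections_iff)
  note mC = cut_off_mats[OF m C] and mD = cut_off_mats[OF m D]
  have "mat_prod ?A n (cut_off X C p) (cut_off X D p) = (\<lambda>_ _. \<zero>\<^bsub>?A\<^esub>)"
  proof (rule cont_fun_mat_ext[OF mat_prod_closed[OF mC mD], of _ n n])
    fix i j x assume "x \<in> topspace X"
    then show "mat_prod ?A n (cut_off X C p) (cut_off X D p) i j x = \<zero>\<^bsub>?A\<^esub> x"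
      using \<open>C \<inter> D = {}\<close> unfolding cont_fun_mat_prod[OF mC mD \<open>x \<in> topspace X\<close>]
      by (auto simp: cont_fun_alg_simps(2) cut_off_def indicator_def intro!: sum.neutral)
  qed (auto simp: mats_def)
  then show ?thesis
    unfolding eq using p C D
    by (intro projection_class_orthogonal_sum cut_off_projection)
      (auto simp: eq[symmetric] intro!: cut_off_projection)
qed

text \<open>On \<open>C\<close> the cut-off is the sum of the rank one part \<open>f\<close> built
  from column \<open>i\<close> and the deflated matrix \<open>q\<close>; off \<open>C\<close> both
  are zero. The two are orthogonal, and the normalised column \<open>v\<close> identifies the class
  of \<open>f\<close> with that of the indicator of \<open>C\<close>.\<close>

lemma cut_off_deflate:
  assumes p: "(n, p) \<in> projections (cont_fun_alg X)" and C: "openin X C" "closedin X C"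
    and i: "\<And>x. x \<in> C \<Longrightarrow> p i i x \<noteq> 0"
  obtains q where "(n, q) \<in> projections (cont_fun_alg X)"
    "\<And>x. x \<in> topspace X \<Longrightarrow> real_trace n (\<lambda>j k. q j k x)
      = (if x \<in> C then real_trace n (\<lambda>j k. p j k x) - 1 else 0)"
    "projection_class (cont_fun_alg X) (n, cut_off X C p)
      = K0_class (cont_fun_alg X) (char_fun X C)
        \<otimes>\<^bsub>K0 (cont_fun_alg X)\<^esub> projection_class (cont_fun_alg X) (n, q)"
proof -
  let ?A = "cont_fun_alg X"
  interpret star_ring ?A by (rule star_ring_cont_fun_alg)
  have n: "n \<ge> 1" and m: "p \<in> mats ?A n n"
    and P: "\<And>x. x \<in> topspace X \<Longrightarrow> complex_projection n (\<lambda>i j. p i j x)"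
    using p by (auto simp: cont_fun_projections_iff)
  note PD = complex_projection_diag_Re[OF P]
  have herm: "cnj (p j k x) = p k j x" if "x \<in> topspace X" for j k x
    using P[OF that] by (auto simp: complex_projection_def)
  have CX: "x \<in> topspace X" if "x \<in> C" for x using C(1) that openin_subset by blast
  have pos: "0 < Re (p i i x)" if "x \<in> C" for x
    using PD[OF CX[OF that], of i] i[OF that] by (metis less_eq_real_def of_real_0)
  note lim = cont_fun_alg_tendsto[OF matsD[OF m]] tendsto_indicator_clopen[OF C]
  \<comment> \<open>On \<open>C\<close> this is \<open>p i i\<close>, elsewhere it is
    \<open>1\<close>. It is continuous and positive everywhere, so dividing by its square root is
    harmless also at zeros of \<open>p i i\<close> outside \<open>C\<close>.\<close>
  define g where "g = (\<lambda>x. indicator C x * p i i x + (1 - indicator C x))"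
  have gpos: "0 < Re (g x)" for x
    using pos by (auto simp: g_def indicator_def)
  define v where "v = (\<lambda>j k. \<lambda>x\<in>topspace X.
    if k = (0::nat) then indicator C x * p j i x / of_real (sqrt (Re (g x))) else 0)"
  have v: "v \<in> mats ?A n 1"
  proof -
    have "v j k \<in> carrier ?A" for j k
    proof (cases "k = 0")
      case True
      have "(\<lambda>x\<in>topspace X. indicator C x * p j i x / of_real (sqrt (Re (g x)))) \<in> carrier ?A"
        using gpos unfolding g_def
        by (intro cont_fun_alg_restrict continuous_map_complexI tendsto_intros lim)
          (auto simp: less_le)
      then show ?thesis using True by (simp add: v_def)
    next
      case False
      then show ?thesis using zero_closed by (simp add: v_def cont_fun_alg_simps(2))
    qed
    moreover have "v j k = \<zero>\<^bsub>?A\<^esub>" if "j \<ge> n \<or> k \<ge> 1" for j k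
      using that mats_zero[OF m, of j i] by (auto simp: v_def cont_fun_alg_simps(2) fun_eq_iff)
    ultimately show ?thesis by (auto simp: mats_def)
  qed
  define f where "f = mat_prod ?A 1 v (mat_star ?A v)"
  have vs: "mat_star ?A v \<in> mats ?A 1 n" by (rule mat_star_closed[OF v])
  have fm: "f \<in> mats ?A n n" unfolding f_def by (rule mat_prod_closed[OF v vs])
  have sq: "of_real (sqrt (Re (p i i x))) * of_real (sqrt (Re (p i i x))) = p i i x" if "x \<in> C" for x
    using pos[OF that] PD(1)[OF CX[OF that], of i]
    by (metis less_imp_le of_real_mult real_sqrt_mult_self abs_of_nonneg)
  have f: "f j k x = indicator C x * (p j i x * p i k x / p i i x)" if "x \<in> topspace X" for j k x
  proof -
    have "f j k x = v j 0 x * cnj (v k 0 x)"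
      using that unfolding f_def cont_fun_mat_prod[OF v vs that]
      by (simp add: mat_star_def cont_fun_alg_simps)
    then show ?thesis
      using that sq by (auto simp: v_def g_def indicator_def herm)
  qed
  \<comment> \<open>Subtracting inside the ring gives continuity of the entries at once; the
    pointwise formula by \<open>deflate\<close> is derived afterwards.\<close>
  define q where "q = (\<lambda>j k. cut_off X C p j k \<ominus>\<^bsub>?A\<^esub> f j k)"
  note mC = cut_off_mats[OF m C]
  have qm: "q \<in> mats ?A n n"
    using matsD[OF mC] matsD[OF fm] mats_zero[OF mC] mats_zero[OF fm]
    by (auto simp: mats_def q_def a_minus_def)
  have sum: "cut_off X C p = (\<lambda>j k. f j k \<oplus>\<^bsub>?A\<^esub> q j k)"
    using matsD[OF mC] matsD[OF fm] unfolding q_def by (intro ext) algebra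
  have q: "q j k x = indicator C x * deflate i (\<lambda>j k. p j k x) j k" if "x \<in> topspace X" for j k x
    using fun_cong[OF fun_cong[OF fun_cong[OF sum]], of j k x] that f[OF that, of j k]
    by (simp add: cont_fun_alg_simps cut_off_def deflate_def algebra_simps)
  note defl = deflate_complex_projection[OF P i, OF CX]
  have qp: "(n, q) \<in> projections ?A"
  proof -
    have "complex_projection n (\<lambda>j k. q j k x)" if "x \<in> topspace X" for x
      using defl(1)[of x] that
      by (cases "x \<in> C") (auto simp: q complex_projection_def)
    then show ?thesis using n qm by (simp add: cont_fun_projections_iff)
  qed
  have fp: "(n, f) \<in> projections ?A"
  proof -
    have "complex_projection n (\<lambda>j k. f j k x)" if x: "x \<in> topspace X" for x
    proof -
      have "(\<Sum>l<n. f j l x * f l k x) = f j k x" for j k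
      proof (cases "x \<in> C")
        case True
        \<comment> \<open>The factors independent of \<open>l\<close> are pulled out, leaving the
          squared norm of row \<open>i\<close>, which cancels one denominator.\<close>
        have "(\<Sum>l<n. f j l x * f l k x)
          = (\<Sum>l<n. p i l x * p l i x) * (p j i x * p i k x / (p i i x * p i i x))"
          using True by (simp add: f[OF x] sum_distrib_left sum_distrib_right sum_divide_distrib mult_ac)
        also have "(\<Sum>l<n. p i l x * p l i x) = p i i x"
          using P[OF x] by (simp add: complex_projection_def)
        finally show ?thesis using True i[OF True] by (simp add: f[OF x])
      qed (simp add: f[OF x])
      moreover have "cnj (f k j x) = f j k x" for j k
        by (simp add: f[OF x] herm[OF x] indicator_def mult.commute)
      ultimately show ?thesis by (simp add: complex_projection_def)
    qed
    then show ?thesis using n fm by (simp add: cont_fun_projections_iff)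
  qed
  have fq: "mat_prod ?A n f q = (\<lambda>_ _. \<zero>\<^bsub>?A\<^esub>)"
  proof (rule cont_fun_mat_ext[OF mat_prod_closed[OF fm qm], of _ n n])
    fix j k x assume x: "x \<in> topspace X"
    show "mat_prod ?A n f q j k x = \<zero>\<^bsub>?A\<^esub> x"
    proof (cases "x \<in> C")
      case True
      \<comment> \<open>The numerator is the orthogonality relation between the deflated matrix and
        its rank one complement.\<close>
      have "mat_prod ?A n f q j k x
        = (\<Sum>l<n. p j i x * p i l x * deflate i (\<lambda>j k. p j k x) l k) / p i i x"
        using True by (simp add: cont_fun_mat_prod[OF fm qm x] f[OF x] q[OF x] sum_divide_distrib)
      then show ?thesis using defl(2)[OF True True] x by (simp add: cont_fun_alg_simps(2))
    next
      case False
      then show ?thesis using x by (simp add: cont_fun_mat_prod[OF fm qm x] f[OF x] cont_fun_alg_simps(2))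
    qed
  qed (auto simp: mats_def)
  have "projection_class ?A (n, f) = K0_class ?A (char_fun X C)"
  proof (rule projection_class_rank_one[OF fp _ _ _ v _ f_def])
    show cc: "char_fun X C \<in> carrier ?A"
      unfolding char_fun_def by (intro cont_fun_alg_restrict continuous_map_complexI lim)
    show "star ?A (char_fun X C) = char_fun X C" "char_fun X C \<otimes>\<^bsub>?A\<^esub> char_fun X C = char_fun X C"
      by (auto simp: char_fun_def cont_fun_alg_simps indicator_def)
    show "mat_prod ?A n (mat_star ?A v) v 0 0 = char_fun X C"
    proof (rule cont_fun_alg_ext[OF matsD[OF mat_prod_closed[OF vs v]] cc])
      fix x assume x: "x \<in> topspace X"
      show "mat_prod ?A n (mat_star ?A v) v 0 0 x = char_fun X C x"
      proof (cases "x \<in> C")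
        case True
        have "mat_prod ?A n (mat_star ?A v) v 0 0 x = (\<Sum>l<n. cnj (v l 0 x) * v l 0 x)"
          using x unfolding cont_fun_mat_prod[OF vs v x] by (simp add: mat_star_def cont_fun_alg_simps)
        \<comment> \<open>The normalisation by \<open>g\<close> divides the squared norm of column
          \<open>i\<close> by \<open>p i i\<close>, so the quotient is \<open>1\<close> on
          \<open>C\<close>.\<close>
        also have "\<dots> = (\<Sum>l<n. p i l x * p l i x) / p i i x"
          using True x sq[OF True] by (simp add: v_def g_def herm sum_divide_distrib)
        also have "(\<Sum>l<n. p i l x * p l i x) = p i i x"
          using P[OF x] by (simp add: complex_projection_def)
        finally show ?thesis using True x i[OF True] by (simp add: char_fun_def)
      next
        case False
        then show ?thesis using x unfolding cont_fun_mat_prod[OF vs v x] by (simp add: v_def char_fun_def)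
      qed
    qed
  qed
  then have "projection_class ?A (n, cut_off X C p)
      = K0_class ?A (char_fun X C) \<otimes>\<^bsub>K0 ?A\<^esub> projection_class ?A (n, q)"
    using projection_class_orthogonal_sum[OF fp qp] cut_off_projection[OF p C] fq sum by simp
  moreover have "real_trace n (\<lambda>j k. q j k x)
      = (if x \<in> C then real_trace n (\<lambda>j k. p j k x) - 1 else 0)" if "x \<in> topspace X" for x
    using defl(3)[of x] that by (simp add: q real_trace_def)
  ultimately show ?thesis using that qp by blast
qed

section \<open>Induction on the trace when open covers have finite clopen partitions as
  refinements\<close>

section \<open>Generators of \<open>K\<^sub>0(C(X))\<close>\<close>

text \<open>Finite additivity over disjoint clopen pieces, by induction from the case of two
  pieces.\<close>

lemma cut_off_Union_mem:
  assumes p: "(n, p) \<in> projections (cont_fun_alg X)" and H: "subgroup H (K0 (cont_fun_alg X))"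
    and P: "finite P" "disjoint P"
    and C: "\<And>C. C \<in> P \<Longrightarrow> openin X C \<and> closedin X C \<and>
      projection_class (cont_fun_alg X) (n, cut_off X C p) \<in> H"
  shows "projection_class (cont_fun_alg X) (n, cut_off X (\<Union>P) p) \<in> H"
  using P C
proof (induction P rule: finite_induct)
  case empty
  have "projection_class (cont_fun_alg X) (n, cut_off X {} p) = \<one>\<^bsub>K0 (cont_fun_alg X)\<^esub>"
    by (rule projection_class_zero_on[OF cut_off_projection[OF p]]) (auto simp: cut_off_def)
  then show ?case using subgroup.one_closed[OF H] by simp
next
  case (insert D P)
  have "D \<inter> \<Union>P = {}" using insert.hyps insert.prems(1) by (auto simp: disjoint_def)
  moreover have "openin X (\<Union>P)" "closedin X (\<Union>P)"
    using insert by (auto intro!: closedin_Union)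
  moreover have "projection_class (cont_fun_alg X) (n, cut_off X (\<Union>P) p) \<in> H"
    using insert.prems by (intro insert.IH) (auto simp: disjoint_def pairwise_insert)
  ultimately show ?case
    using insert.prems(2)[of D] cut_off_Un[OF p, of D "\<Union>P"] subgroup.m_closed[OF H] by simp
qed

text \<open>This separates K-theory from group theory: of the space, only a clopen family
  \<open>\<B>\<close> that partitions \<open>X\<close> finitely below any open cover enters the
  induction on the trace.\<close>

theorem K0_cont_fun_alg_generators:
  fixes X :: "'a topology" and \<B> :: "'a set set"
  assumes clopen: "\<And>B. B \<in> \<B> \<Longrightarrow> openin X B \<and> closedin X B"
    and refine: "\<And>\<U>. (\<And>U. U \<in> \<U> \<Longrightarrow> openin X U) \<Longrightarrow> \<Union>\<U> = topspace X \<Longrightarrow>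
      \<exists>P\<subseteq>\<B>. finite P \<and> disjoint P \<and> \<Union>P = topspace X \<and> (\<forall>C\<in>P. \<exists>U\<in>\<U>. C \<subseteq> U)"
  shows "generate (K0 (cont_fun_alg X)) {K0_class (cont_fun_alg X) (char_fun X B) | B. B \<in> \<B>}
    = carrier (K0 (cont_fun_alg X))" (is "generate ?K ?S = _")
proof -
  let ?A = "cont_fun_alg X"
  interpret star_ring ?A by (rule star_ring_cont_fun_alg)
  interpret K: comm_group ?K by (rule comm_group_K0)
  have "K0_class ?A (char_fun X B) \<in> carrier ?K" if "B \<in> \<B>" for B
  proof (rule K0_class_closed)
    show "char_fun X B \<in> carrier ?A"
      unfolding char_fun_def using clopen[OF that]
      by (intro cont_fun_alg_restrict continuous_map_complexI tendsto_indicator_clopen) auto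
  qed (auto simp: char_fun_def cont_fun_alg_simps indicator_def)
  then have S: "?S \<subseteq> carrier ?K" by auto
  have H: "subgroup (generate ?K ?S) ?K" by (rule K.generate_is_subgroup[OF S])
  \<comment> \<open>The induction runs over a strict upper bound \<open>k\<close> for the trace,
    with the matrix size fixed and the projection arbitrary.\<close>
  have step: "projection_class ?A (n, p) \<in> generate ?K ?S"
    if "(n, p) \<in> projections ?A" "\<And>x. x \<in> topspace X \<Longrightarrow> real_trace n (\<lambda>i j. p i j x) < real k"
    for n p k
    using that
  proof (induction k arbitrary: p)
    \<comment> \<open>Traces are nonnegative, so the bound \<open>0\<close> forces the space to be
      empty.\<close>
    case 0
    have False if "x \<in> topspace X" for x
      using 0(2)[OF that] real_trace_nonneg[of n "\<lambda>i j. p i j x"] 0(1) that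
      by (auto simp: cont_fun_projections_iff)
    then have "projection_class ?A (n, p) = \<one>\<^bsub>?K\<^esub>"
      by (intro projection_class_zero_on[OF 0(1)]) auto
    then show ?case using subgroup.one_closed[OF H] by simp
  next
    case (Suc k)
    have m: "p \<in> mats ?A n n"
      and P: "\<And>x. x \<in> topspace X \<Longrightarrow> complex_projection n (\<lambda>i j. p i j x)"
      using Suc.prems(1) by (auto simp: cont_fun_projections_iff)
    define tr where "tr = (\<lambda>x. real_trace n (\<lambda>i j. p i j x))"
    have cont: "continuous_map X euclideanreal (\<lambda>x. Re (p i i x))" for i
      using cont_fun_alg_tendsto[OF matsD[OF m, of i i]]
      by (auto simp: continuous_map_atin intro!: tendsto_Re)
    then have "continuous_map X euclideanreal tr"
      unfolding tr_def real_trace_def by (intro continuous_map_sum) auto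
    from openin_continuous_map_preimage[OF this, of "{..<1}"]
    have o1: "openin X {x \<in> topspace X. tr x < 1}" by simp
    have o2: "openin X {x \<in> topspace X. 0 < Re (p i i x)}" for i
      using openin_continuous_map_preimage[OF cont[of i], of "{0<..}"] by simp
    define \<U> where "\<U> = insert {x \<in> topspace X. tr x < 1}
      ((\<lambda>i. {x \<in> topspace X. 0 < Re (p i i x)}) ` {..<n})"
    have "openin X U" if "U \<in> \<U>" for U using that o1 o2 by (auto simp: \<U>_def)
    moreover have "\<Union>\<U> = topspace X"
    proof -
      have "\<exists>i<n. 0 < Re (p i i x)" if "x \<in> topspace X" "\<not> tr x < 1" for x
      proof (rule ccontr)
        assume "\<not> ?thesis"
        then have "tr x \<le> 0" unfolding tr_def real_trace_def by (intro sum_nonpos) (auto simp: not_less[symmetric])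
        then show False using that(2) by simp
      qed
      then show ?thesis by (auto simp: \<U>_def)
    qed
    ultimately obtain Q where Q: "Q \<subseteq> \<B>" "finite Q" "disjoint Q" "\<Union>Q = topspace X"
      "\<And>C. C \<in> Q \<Longrightarrow> \<exists>U\<in>\<U>. C \<subseteq> U" using refine[of \<U>] by auto
    have "projection_class ?A (n, cut_off X C p) \<in> generate ?K ?S" if "C \<in> Q" for C
    proof -
      have C: "C \<in> \<B>" "openin X C" "closedin X C" using that Q(1) clopen by auto
      \<comment> \<open>The second alternative records \<open>k > 0\<close> because the deflated
        projection has trace \<open>0\<close> off \<open>C\<close>, which must stay strictly below
        \<open>k\<close>. If \<open>k = 0\<close>, the trace is below \<open>1\<close> everywhere
        and the first alternative applies.\<close>
      consider "\<And>x. x \<in> C \<Longrightarrow> tr x < 1" | i where "k > 0" "\<And>x. x \<in> C \<Longrightarrow> 0 < Re (p i i x)"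
      proof (cases "k = 0")
        case True
        then show ?thesis
          using that(1) Suc.prems(2) openin_subset[OF C(2)] by (auto simp: tr_def)
      next
        case False
        then show ?thesis using that Q(5)[OF \<open>C \<in> Q\<close>] by (auto simp: \<U>_def)
      qed
      then show ?thesis
      proof cases
        case 1
        have "projection_class ?A (n, cut_off X C p) = \<one>\<^bsub>?K\<^esub>"
        proof (rule projection_class_zero_on[OF cut_off_projection[OF Suc.prems(1) C(2,3)]])
          fix i j x assume "i < n" "j < n" and x: "x \<in> topspace X"
          then show "cut_off X C p i j x = 0"
            using real_trace_less_1[OF P[OF x]] 1[of x]
            by (auto simp: cut_off_def indicator_def tr_def)
        qed
        then show ?thesis using subgroup.one_closed[OF H] by simp
      next
        case 2
        then have "p i i x \<noteq> 0" if "x \<in> C" for x using that by force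
        from cut_off_deflate[OF Suc.prems(1) C(2,3) this]
        obtain q where q: "(n, q) \<in> projections ?A"
          "\<And>x. x \<in> topspace X \<Longrightarrow> real_trace n (\<lambda>j k. q j k x)
            = (if x \<in> C then real_trace n (\<lambda>j k. p j k x) - 1 else 0)"
          and eq: "projection_class ?A (n, cut_off X C p)
            = K0_class ?A (char_fun X C) \<otimes>\<^bsub>?K\<^esub> projection_class ?A (n, q)" by blast
        have "real_trace n (\<lambda>j k. q j k x) < real k" if "x \<in> topspace X" for x
          using q(2)[OF that] Suc.prems(2)[OF that] \<open>k > 0\<close> by auto
        then have "projection_class ?A (n, q) \<in> generate ?K ?S" by (rule Suc.IH[OF q(1)])
        moreover have "K0_class ?A (char_fun X C) \<in> generate ?K ?S"
          using C(1) by (blast intro: generate.incl)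
        ultimately show ?thesis unfolding eq by (rule subgroup.m_closed[OF H, rotated])
      qed
    qed
    then have "projection_class ?A (n, cut_off X (\<Union>Q) p) \<in> generate ?K ?S"
      using Q clopen by (intro cut_off_Union_mem[OF Suc.prems(1) H]) auto
    moreover have "cut_off X (\<Union>Q) p = p"
      by (rule cont_fun_mat_ext[OF cut_off_mats[OF m] m]) (auto simp: Q(4) cut_off_def)
    ultimately show ?case by simp
  qed
  have "projection_class ?A x \<in> generate ?K ?S" if "x \<in> projections ?A" for x
  proof -
    obtain n p where x: "x = (n, p)" by (cases x)
    \<comment> \<open>Diagonal entries are at most \<open>1\<close>, so the trace is at most
      \<open>n\<close> and \<open>Suc n\<close> is a strict bound.\<close>
    have "real_trace n (\<lambda>i j. p i j y) < real (Suc n)" if "y \<in> topspace X" for y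
    proof -
      have "complex_projection n (\<lambda>i j. p i j y)"
        using \<open>x \<in> projections ?A\<close> that by (simp add: x cont_fun_projections_iff)
      then have "real_trace n (\<lambda>i j. p i j y) \<le> (\<Sum>i<n. 1)"
        unfolding real_trace_def by (intro sum_mono complex_projection_diag_le_1) auto
      then show ?thesis by simp
    qed
    then show ?thesis using step that unfolding x by blast
  qed
  then show ?thesis by (rule K0_carrier_eq_subgroup[OF H])
qed

section \<open>Clopen cosets and refinement of open covers by compactness\<close>

section \<open>Cosets in a compact Vilenkin group\<close>

text \<open>The translate of \<open>H\<close> by \<open>x\<close> is the preimage of
  \<open>H\<close> under translation by the inverse of \<open>x\<close>. Here \<open>H\<close> is
  any open set, so the lemma also moves neighbourhoods to the identity.\<close>

lemma openin_l_coset: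
  assumes "topological_group G T" "x \<in> carrier G" "openin T H"
  shows "openin T (x <#\<^bsub>G\<^esub> H)"
proof -
  interpret group G using assms by (simp add: topological_group_def)
  have top: "topspace T = carrier G" using assms by (simp add: topological_group_def)
  have H: "H \<subseteq> carrier G" using openin_subset[OF assms(3)] top by simp
  have "continuous_map T T ((\<lambda>(x, y). x \<otimes>\<^bsub>G\<^esub> y) \<circ> (\<lambda>y. (inv\<^bsub>G\<^esub> x, y)))"
    using assms by (intro continuous_map_compose[where X' = "prod_topology T T"])
      (auto simp: topological_group_def continuous_map_pairedI)
  then have "openin T {y \<in> topspace T. inv\<^bsub>G\<^esub> x \<otimes>\<^bsub>G\<^esub> y \<in> H}"
    using openin_continuous_map_preimage[OF _ assms(3)] by (fastforce simp: o_def)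
  also have "{y \<in> topspace T. inv\<^bsub>G\<^esub> x \<otimes>\<^bsub>G\<^esub> y \<in> H} = x <#\<^bsub>G\<^esub> H"
  proof (intro equalityI subsetI)
    fix y assume "y \<in> {y \<in> topspace T. inv\<^bsub>G\<^esub> x \<otimes>\<^bsub>G\<^esub> y \<in> H}"
    then show "y \<in> x <#\<^bsub>G\<^esub> H"
      using assms(2) unfolding l_coset_def top
      by (auto simp: m_assoc[symmetric] intro!: bexI[of _ "inv\<^bsub>G\<^esub> x \<otimes>\<^bsub>G\<^esub> y"])
  next
    fix y assume "y \<in> x <#\<^bsub>G\<^esub> H"
    then show "y \<in> {y \<in> topspace T. inv\<^bsub>G\<^esub> x \<otimes>\<^bsub>G\<^esub> y \<in> H}"
      using assms(2) H unfolding l_coset_def top by (auto simp: m_assoc[symmetric] subset_iff)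
  qed
  finally show ?thesis .
qed

lemma (in group) l_coset_disjoint:
  assumes "subgroup H G" "x \<in> carrier G" "y \<in> carrier G" "(x <# H) \<inter> (y <# H) \<noteq> {}"
  shows "x <# H = y <# H"
proof -
  obtain z where "z \<in> x <# H" "z \<in> y <# H" using assms(4) by blast
  then show ?thesis
    using l_repr_independence[OF _ assms(2,1)] l_repr_independence[OF _ assms(3,1)] by metis
qed

lemma (in group) lcos_self: "subgroup H G \<Longrightarrow> x \<in> carrier G \<Longrightarrow> x \<in> x <# H"
  by (auto simp: l_coset_def subgroup.one_closed intro!: bexI[of _ \<one>])

text \<open>The complement is a union of other cosets of the open subgroup \<open>H\<close>, hence
  open.\<close>

lemma closedin_l_coset:
  assumes "topological_group G T" "x \<in> carrier G" "openin T H" "subgroup H G"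
  shows "closedin T (x <#\<^bsub>G\<^esub> H)"
proof -
  interpret group G using assms by (simp add: topological_group_def)
  have top: "topspace T = carrier G" using assms by (simp add: topological_group_def)
  have "openin T (topspace T - (x <#\<^bsub>G\<^esub> H))"
  proof (subst openin_subopen, intro ballI exI conjI)
    fix y assume y: "y \<in> topspace T - (x <#\<^bsub>G\<^esub> H)"
    then have yc: "y \<in> carrier G" by (simp add: top)
    show "openin T (y <#\<^bsub>G\<^esub> H)" by (rule openin_l_coset[OF assms(1) yc assms(3)])
    show yy: "y \<in> y <#\<^bsub>G\<^esub> H" by (rule lcos_self[OF assms(4) yc])
    have "(x <#\<^bsub>G\<^esub> H) \<inter> (y <#\<^bsub>G\<^esub> H) = {}"
      using l_coset_disjoint[OF assms(4,2) yc] y yy by blast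
    then show "y <#\<^bsub>G\<^esub> H \<subseteq> topspace T - (x <#\<^bsub>G\<^esub> H)"
      using openin_subset[OF openin_l_coset[OF assms(1) yc assms(3)]] by blast
  qed
  then show ?thesis
    using openin_subset[OF openin_l_coset[OF assms(1-3)]] by (simp add: closedin_def)
qed

text \<open>Compactness is used twice. It first gives finitely many cosets, of varying levels, that
  lie in members of the cover and exhaust \<open>G\<close>. With \<open>R\<close> the largest of
  these levels, each coset of \<open>N R\<close> lies in one of them; finitely many cosets of
  \<open>N R\<close> then cover \<open>G\<close>, and distinct ones are disjoint.\<close>

lemma associated_sequence_refine:
  assumes tg: "topological_group G T" and N: "associated_sequence G T N"
    and U: "\<And>U. U \<in> \<U> \<Longrightarrow> openin T U" "\<Union>\<U> = topspace T"
  shows "\<exists>P\<subseteq>{x <#\<^bsub>G\<^esub> N r | x r. x \<in> carrier G}.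
    finite P \<and> disjoint P \<and> \<Union>P = topspace T \<and> (\<forall>C\<in>P. \<exists>U\<in>\<U>. C \<subseteq> U)"
proof -
  interpret group G using tg by (simp add: topological_group_def)
  have top: "topspace T = carrier G" using tg by (simp add: topological_group_def)
  have sub: "subgroup (N r) G" and op: "openin T (N r)" for r
    using N by (auto simp: associated_sequence_def normal_imp_subgroup)
  have "compactin T (carrier G)" using N unfolding associated_sequence_def by metis
  then have comp: "\<exists>\<F>. finite \<F> \<and> \<F> \<subseteq> \<V> \<and> carrier G \<subseteq> \<Union>\<F>"
    if "\<forall>V\<in>\<V>. openin T V" "carrier G \<subseteq> \<Union>\<V>" for \<V>
    using that unfolding compactin_def by metis
  have dec: "N n \<subseteq> N m" if "m \<le> n" for m n
    using N lift_Suc_antimono_le[of N m n] that by (auto simp: associated_sequence_def less_le)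
  define \<V> where "\<V> = {V. (\<exists>U\<in>\<U>. V \<subseteq> U) \<and> (\<exists>r. \<exists>x\<in>carrier G. V = x <#\<^bsub>G\<^esub> N r)}"
  \<comment> \<open>The basis property is given at the identity only, so \<open>U\<close> is
    translated there by the inverse of \<open>x\<close> and the resulting \<open>N r\<close> is
    translated back.\<close>
  have nbhd: "\<exists>r. x <#\<^bsub>G\<^esub> N r \<subseteq> U" if x: "x \<in> U" and "U \<in> \<U>" for x U
  proof -
    have xc: "x \<in> carrier G" using that U(2) top by auto
    have "openin T (inv\<^bsub>G\<^esub> x <#\<^bsub>G\<^esub> U)" using openin_l_coset[OF tg] xc U(1)[OF that(2)] by simp
    moreover have "\<one>\<^bsub>G\<^esub> \<in> inv\<^bsub>G\<^esub> x <#\<^bsub>G\<^esub> U"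
      unfolding l_coset_def using x xc by (auto intro!: bexI[of _ x])
    ultimately obtain r where r: "N r \<subseteq> inv\<^bsub>G\<^esub> x <#\<^bsub>G\<^esub> U"
      using N by (auto simp: associated_sequence_def)
    have "U \<subseteq> carrier G" using that(2) U(2) top by auto
    then have "x <#\<^bsub>G\<^esub> N r \<subseteq> U"
      using r xc by (fastforce simp: l_coset_def m_assoc[symmetric])
    then show ?thesis ..
  qed
  have "carrier G \<subseteq> \<Union>\<V>"
  proof
    fix x assume x: "x \<in> carrier G"
    then obtain U where "U \<in> \<U>" "x \<in> U" using U(2) top by auto
    moreover from this obtain r where "x <#\<^bsub>G\<^esub> N r \<subseteq> U" using nbhd by metis
    ultimately have "x <#\<^bsub>G\<^esub> N r \<in> \<V>"
      unfolding \<V>_def using x by (intro CollectI conjI exI[of _ r] bexI[of _ x] bexI[of _ U]) auto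
    then show "x \<in> \<Union>\<V>" using lcos_self[OF sub x] by (rule UnionI)
  qed
  moreover have "\<forall>V\<in>\<V>. openin T V" using openin_l_coset[OF tg] op by (auto simp: \<V>_def)
  ultimately obtain \<F> where F: "finite \<F>" "\<F> \<subseteq> \<V>" "carrier G \<subseteq> \<Union>\<F>"
    using comp by metis
  have "\<forall>V\<in>\<F>. \<exists>r. \<exists>x\<in>carrier G. V = x <#\<^bsub>G\<^esub> N r"
    using F(2) unfolding \<V>_def by (simp add: subset_iff)
  then obtain r where r: "\<forall>V\<in>\<F>. \<exists>x\<in>carrier G. V = x <#\<^bsub>G\<^esub> N (r V)"
    by (rule bchoice[THEN exE])
  \<comment> \<open>Inserting \<open>0\<close> keeps the set nonempty, as \<open>Max\<close>
    requires.\<close>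
  define R where "R = Max (insert 0 (r ` \<F>))"
  have R: "r V \<le> R" if "V \<in> \<F>" for V using F(1) that by (simp add: R_def)
  define \<W> where "\<W> = (\<lambda>y. y <#\<^bsub>G\<^esub> N R) ` carrier G"
  have "carrier G \<subseteq> \<Union>\<W>" using lcos_self[OF sub] by (auto simp: \<W>_def)
  moreover have W: "\<forall>V\<in>\<W>. openin T V" using openin_l_coset[OF tg] op by (auto simp: \<W>_def)
  ultimately obtain P where P: "finite P" "P \<subseteq> \<W>" "carrier G \<subseteq> \<Union>P" using comp by metis
  have "disjoint P"
  proof (rule disjointI)
    fix C D assume CD: "C \<in> P" "D \<in> P" "C \<noteq> D"
    then obtain x y where "x \<in> carrier G" "C = x <#\<^bsub>G\<^esub> N R" "y \<in> carrier G" "D = y <#\<^bsub>G\<^esub> N R"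
      using P(2) unfolding \<W>_def by (meson imageE subsetD)
    then show "C \<inter> D = {}" using l_coset_disjoint[OF sub] CD(3) by metis
  qed
  moreover have "\<Union>P = topspace T"
  proof
    show "\<Union>P \<subseteq> topspace T" using P(2) W by (intro Union_least openin_subset) auto
  qed (simp add: top P(3))
  moreover have "\<exists>U\<in>\<U>. C \<subseteq> U" if "C \<in> P" for C
  proof -
    obtain y where y: "y \<in> carrier G" "C = y <#\<^bsub>G\<^esub> N R"
      using \<open>C \<in> P\<close> P(2) by (auto simp: \<W>_def)
    then obtain V where V: "V \<in> \<F>" "y \<in> V" using F(3) by auto
    then obtain x where x: "x \<in> carrier G" "V = x <#\<^bsub>G\<^esub> N (r V)" using r by metis
    \<comment> \<open>A coset is represented by any of its points, so \<open>V\<close> may be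
      written with \<open>y\<close>; then \<open>N R \<subseteq> N (r V)\<close> places
      \<open>C\<close> inside \<open>V\<close>.\<close>
    have "V = y <#\<^bsub>G\<^esub> N (r V)"
      using l_repr_independence[OF _ x(1) sub] V(2) x(2) by metis
    moreover have "C \<subseteq> y <#\<^bsub>G\<^esub> N (r V)" using dec[OF R[OF V(1)]] y(2) by (auto simp: l_coset_def)
    moreover have "\<exists>U\<in>\<U>. V \<subseteq> U" using V(1) F(2) by (auto simp: \<V>_def)
    ultimately show ?thesis by (metis order_trans)
  qed
  moreover have "\<W> \<subseteq> {x <#\<^bsub>G\<^esub> N r | x r. x \<in> carrier G}"
    unfolding \<W>_def by (intro image_subsetI CollectI exI conjI) (rule refl)
  then have "P \<subseteq> {x <#\<^bsub>G\<^esub> N r | x r. x \<in> carrier G}" by (rule order_trans[OF P(2)])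
  ultimately show ?thesis using P(1) by (intro exI[of _ P]) simp
qed

theorem proposition4p1:
  fixes G :: "('g, 'm) monoid_scheme"
    and T :: "'g topology"
    and N :: "nat \<Rightarrow> 'g set"
  assumes "compact_Vilenkin_group G T"
    and "associated_sequence G T N"
  shows "carrier (K0 (cont_fun_alg T)) =
    generate (K0 (cont_fun_alg T))
      {K0_class (cont_fun_alg T) (char_fun T (x <#\<^bsub>G\<^esub> N r)) | x r. x \<in> carrier G}"
proof -
  have tg: "topological_group G T" using assms(1) by (simp add: compact_Vilenkin_group_def)
  \<comment> \<open>The cosets of all levels together serve as the clopen family \<open>\<B>\<close>
    of the general result.\<close>
  let ?B = "{x <#\<^bsub>G\<^esub> N r | x r. x \<in> carrier G}"
  have "openin T B \<and> closedin T B" if "B \<in> ?B" for B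
    using that assms(2) openin_l_coset[OF tg] closedin_l_coset[OF tg]
    by (auto simp: associated_sequence_def normal_imp_subgroup)
  then have "generate (K0 (cont_fun_alg T)) {K0_class (cont_fun_alg T) (char_fun T B) | B. B \<in> ?B}
    = carrier (K0 (cont_fun_alg T))"
    by (rule K0_cont_fun_alg_generators[OF _ associated_sequence_refine[OF tg assms(2)]])
  moreover have "{K0_class (cont_fun_alg T) (char_fun T B) | B. B \<in> ?B}
    = {K0_class (cont_fun_alg T) (char_fun T (x <#\<^bsub>G\<^esub> N r)) | x r. x \<in> carrier G}" by blast
  ultimately show ?thesis by simp
qed

end
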